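(* Let $(\mathcal{E},\mathcal{D}(\mathcal{E}))$ be an irreducible regular Dirichlet form on $L^2(E;m)$, let $\mu$ be a signed smooth Radon measure such that $(\mathcal{E}^{\mu},\mathcal{D}(\mathcal{E})\cap C_c(E))$ is non-negative definite and closable, and let $\Phi$ be a Bernstein function with drift $b$ and Lévy measure $\nu$ such that either $b>0$ or $\inf \operatorname{supp}(\nu)=0$. If the Schrödinger form $(\mathcal{E}^{\mu},\mathcal{D}(\mathcal{E}^{\mu}))$ is subcritical, then so is the subordinated Schrödinger form $(\mathcal{E}^{\mu,\Phi},\mathcal{D}(\mathcal{E}^{\mu,\Phi}))$.
   Context: Setting. $E$ is a locally compact separable metric space, $m$ a positive Radon measure on $E$ with full support, $\langle\cdot,\cdot\rangle_m$ the inner product of real $L^2(E;m)$. A Dirichlet form $(\mathcal{E},\mathcal{D}(\mathcal{E}))$ is a densely defined, non-negative definite, symmetric, closed bilinear form on $L^2(E;m)$ that is Markovian: $f\in\mathcal{D}(\mathcal{E})$ implies $g:=(0\vee f)\wedge1\in\mathcal{D}(\mathcal{E})$ and $\mathcal{E}(g,g)\le\mathcal{E}(f,f)$. Put $\mathcal{E}_1:=\mathcal{E}+\langle\cdot,\cdot\rangle_m$. It is regular if $\mathcal{D}(\mathcal{E})\cap C_c(E)$ is $\mathcal{E}_1$-dense in $\mathcal{D}(\mathcal{E})$ and sup-norm dense in $C_c(E)$ (continuous functions with compact support). With $\mathcal{L}$ the non-positive self-adjoint operator such that $\mathcal{D}(\mathcal{E})=\mathcal{D}(\sqrt{-\mathcal{L}})$,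 $\mathcal{E}(f,g)=\langle\sqrt{-\mathcal{L}}f,\sqrt{-\mathcal{L}}g\rangle_m$, and $T_t=e^{t\mathcal{L}}$, the form is irreducible if every measurable $A$ with $T_t(1_Af)=1_AT_tf$ for all $t>0$, $f\in L^2(E;m)$ satisfies $m(A)=0$ or $m(A^c)=0$. A nest is an increasing sequence of closed sets $F_k$ with $\bigcup_k\{f\in\mathcal{D}(\mathcal{E}): f=0\ m\text{-a.e. on }E\setminus F_k\}$ $\mathcal{E}_1$-dense in $\mathcal{D}(\mathcal{E})$; a set is $\mathcal{E}$-polar if it is contained in $\bigcap_k(E\setminus F_k)$ for some nest. A positive Borel measure is smooth if it charges no $\mathcal{E}$-polar set and is finite on each $F_k$ of some nest. A signed smooth Radon measure is $\mu=\mu^+-\mu^-$ with $\mu^\pm$ smooth Radon measures. Schrödinger form. $\mathcal{E}^\mu(f,g):=\mathcal{E}(f,g)+\int_E fg\,d\mu^+-\int_E fg\,d\mu^-$ for $f,g\in\mathcal{D}(\mathcal{E})\cap C_c(E)$. When this is non-negative definite and closable on $L^2(E;m)$, $(\mathcal{E}^\mu,\mathcal{D}(\mathcal{E}^\mu))$ denotes its closure, $\mathcal{L}^\mu$ ("$=\mathcal{L}-\mu$") the associated non-positive self-adjoint operator and $T_t^\mu=e^{t\mathcal{L}^\mu}$ (a positivity preserving semigroup). Subordination. A Bernstein function here is $\Phi(\lambda)=b\lambda+\int_0^\infty(1-e^{-\lambda s})\,\nu(ds)$ with $b\ge0$ and $\nu$ a Radon measure on $(0,\infty)$ with $\int_0^\infty(1\wedge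 s)\,\nu(ds)<\infty$. Put $\mathcal{L}^{\mu,\Phi}:=-\Phi(-\mathcal{L}^\mu)$; the subordinated Schrödinger form is $\mathcal{D}(\mathcal{E}^{\mu,\Phi})=\mathcal{D}(\sqrt{-\mathcal{L}^{\mu,\Phi}})$, $\mathcal{E}^{\mu,\Phi}(f,g)=\langle\sqrt{-\mathcal{L}^{\mu,\Phi}}f,\sqrt{-\mathcal{L}^{\mu,\Phi}}g\rangle_m$. Extended spaces and subcriticality. For $\mathcal{A}=\mathcal{E}^\mu$ or $\mathcal{A}=\mathcal{E}^{\mu,\Phi}$, $\mathcal{D}_e(\mathcal{A})$ is the set of ($m$-classes of) $m$-a.e. finite measurable $f$ for which there is an $\mathcal{A}$-Cauchy sequence $\{f_n\}\subset\mathcal{D}(\mathcal{A})$ with $f_n\to f$ $m$-a.e.; $\mathcal{A}(f,f):=\lim_n\mathcal{A}(f_n,f_n)$ (well defined). The form $(\mathcal{A},\mathcal{D}(\mathcal{A}))$ is subcritical if there is a strictly positive bounded $g\in L^1(E;m)$ with $\int_E|f|g\,dm\le\sqrt{\mathcal{A}(f,f)}$ for all $f\in\mathcal{D}_e(\mathcal{A})$. *)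

theory Defs
  imports "HOL-Analysis.Analysis"
begin

section \<open>The space \<open>L\<^sup>2(E;m)\<close>\<close>

text \<open>Elements of \<open>L\<^sup>2(E;m)\<close> are represented by functions, not by equivalence classes. Consequently
  a subspace is required to be closed under equality almost everywhere (and a form to respect it), and
  linear operators are given by their graphs, which contain all representatives.\<close>

definition L2 :: "'a measure \<Rightarrow> ('a \<Rightarrow> real) set" where
  "L2 m = {f \<in> borel_measurable m. integrable m (\<lambda>x. (f x)\<^sup>2)}"

definition l2_inner :: "'a measure \<Rightarrow> ('a \<Rightarrow> real) \<Rightarrow> ('a \<Rightarrow> real) \<Rightarrow> real" where
  "l2_inner m f g = (LINT x|m. f x * g x)"

definition l2_tendsto :: "'a measure \<Rightarrow> (nat \<Rightarrow> 'a \<Rightarrow> real) \<Rightarrow> ('a \<Rightarrow> real) \<Rightarrow> bool" where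
  "l2_tendsto m fs f \<longleftrightarrow> (\<lambda>n. LINT x|m. (fs n x - f x)\<^sup>2) \<longlonglongrightarrow> 0"

definition l2_dense :: "'a measure \<Rightarrow> ('a \<Rightarrow> real) set \<Rightarrow> bool" where
  "l2_dense m D \<longleftrightarrow> (\<forall>f\<in>L2 m. \<exists>fs. (\<forall>n. fs n \<in> D) \<and> l2_tendsto m fs f)"

definition l2_subspace :: "'a measure \<Rightarrow> ('a \<Rightarrow> real) set \<Rightarrow> bool" where
  "l2_subspace m D \<longleftrightarrow>
     D \<subseteq> L2 m \<and> (\<lambda>x. 0) \<in> D \<and>
     (\<forall>f\<in>D. \<forall>g\<in>D. \<forall>c d. (\<lambda>x. c * f x + d * g x) \<in> D) \<and>
     (\<forall>f\<in>D. \<forall>g\<in>borel_measurable m. (AE x in m. f x = g x) \<longrightarrow> g \<in> D)"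


section \<open>Operators and functional calculus\<close>

type_synonym 'a l2_op = "(('a \<Rightarrow> real) \<times> ('a \<Rightarrow> real)) set"

definition op_neg :: "'a l2_op \<Rightarrow> 'a l2_op" where
  "op_neg A = {(f, \<lambda>x. - h x) |f h. (f, h) \<in> A}"

definition op_adjoint :: "'a measure \<Rightarrow> 'a l2_op \<Rightarrow> 'a l2_op" where
  "op_adjoint m A =
     {(f, h). f \<in> L2 m \<and> h \<in> L2 m \<and> (\<forall>(u, v)\<in>A. l2_inner m v f = l2_inner m u h)}"

definition self_adjoint :: "'a measure \<Rightarrow> 'a l2_op \<Rightarrow> bool" where
  "self_adjoint m A \<longleftrightarrow> l2_dense m (Domain A) \<and> A = op_adjoint m A"

definition nonpositive_op :: "'a measure \<Rightarrow> 'a l2_op \<Rightarrow> bool" where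
  "nonpositive_op m A \<longleftrightarrow> (\<forall>(f, h)\<in>A. l2_inner m h f \<le> 0)"

text \<open>Projection-valued measures on the Borel sets of the real line. Symmetry makes each \<open>P B\<close> linear
  and compatible with equality almost everywhere; together with multiplicativity it makes
  \<open>P B\<close> an orthogonal projection. Countable additivity is in the strong operator topology.\<close>

definition spectral_measure ::
    "'a measure \<Rightarrow> (real set \<Rightarrow> ('a \<Rightarrow> real) \<Rightarrow> ('a \<Rightarrow> real)) \<Rightarrow> bool" where
  "spectral_measure m P \<longleftrightarrow>
     (\<forall>B\<in>sets borel. \<forall>f\<in>L2 m. P B f \<in> L2 m) \<and>
     (\<forall>B\<in>sets borel. \<forall>f\<in>L2 m. \<forall>g\<in>L2 m. l2_inner m (P B f) g = l2_inner m f (P B g)) \<and>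
     (\<forall>B\<in>sets borel. \<forall>C\<in>sets borel. \<forall>f\<in>L2 m. AE x in m. P B (P C f) x = P (B \<inter> C) f x) \<and>
     (\<forall>f\<in>L2 m. AE x in m. P UNIV f x = f x) \<and>
     (\<forall>B. range B \<subseteq> sets borel \<and> disjoint_family B \<longrightarrow>
        (\<forall>f\<in>L2 m. l2_tendsto m (\<lambda>n x. \<Sum>i<n. P (B i) f x) (P (\<Union>i. B i) f)))"

text \<open>The measure \<open>B \<mapsto> \<langle>P B f, f\<rangle>\<close>.\<close>

definition scalar_measure ::
    "'a measure \<Rightarrow> (real set \<Rightarrow> ('a \<Rightarrow> real) \<Rightarrow> ('a \<Rightarrow> real)) \<Rightarrow> ('a \<Rightarrow> real) \<Rightarrow> real measure" where
  "scalar_measure m P f = measure_of UNIV (sets borel) (\<lambda>B. ennreal (l2_inner m (P B f) f))"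

definition spectral_domain ::
    "'a measure \<Rightarrow> (real set \<Rightarrow> ('a \<Rightarrow> real) \<Rightarrow> ('a \<Rightarrow> real)) \<Rightarrow> (real \<Rightarrow> real) \<Rightarrow> ('a \<Rightarrow> real) set" where
  "spectral_domain m P \<phi> = {f \<in> L2 m. (\<integral>\<^sup>+l. ennreal ((\<phi> l)\<^sup>2) \<partial>scalar_measure m P f) < \<infinity>}"

text \<open>The integral of \<open>\<phi>\<close> against the signed measure \<open>B \<mapsto> \<langle>P B f, g\<rangle>\<close>, by polarization.\<close>

definition polar_integral ::
    "'a measure \<Rightarrow> (real set \<Rightarrow> ('a \<Rightarrow> real) \<Rightarrow> ('a \<Rightarrow> real)) \<Rightarrow> (real \<Rightarrow> real) \<Rightarrow>
     ('a \<Rightarrow> real) \<Rightarrow> ('a \<Rightarrow> real) \<Rightarrow> real" where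
  "polar_integral m P \<phi> f g =
     ((LINT l|scalar_measure m P (\<lambda>x. f x + g x). \<phi> l)
      - (LINT l|scalar_measure m P (\<lambda>x. f x - g x). \<phi> l)) / 4"

text \<open>The operator \<open>\<integral>\<phi> dP\<close>: its value \<open>h\<close> at \<open>f\<close> is determined by \<open>\<langle>h, g\<rangle> = \<integral>\<phi> d\<langle>P f, g\<rangle>\<close>.
  Testing with \<open>g\<close> in the (dense) domain suffices and makes the polarized integrals finite.\<close>

definition spectral_integral ::
    "'a measure \<Rightarrow> (real set \<Rightarrow> ('a \<Rightarrow> real) \<Rightarrow> ('a \<Rightarrow> real)) \<Rightarrow> (real \<Rightarrow> real) \<Rightarrow> 'a l2_op" where
  "spectral_integral m P \<phi> =
     {(f, h). f \<in> spectral_domain m P \<phi> \<and> h \<in> L2 m \<and>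
        (\<forall>g\<in>spectral_domain m P \<phi>. l2_inner m h g = polar_integral m P \<phi> f g)}"

definition spectral_resolution ::
    "'a measure \<Rightarrow> 'a l2_op \<Rightarrow> (real set \<Rightarrow> ('a \<Rightarrow> real) \<Rightarrow> ('a \<Rightarrow> real)) \<Rightarrow> bool" where
  "spectral_resolution m A P \<longleftrightarrow> spectral_measure m P \<and> A = spectral_integral m P (\<lambda>l. l)"

text \<open>The operator \<open>\<phi>(A)\<close> for self-adjoint \<open>A\<close>. By the spectral theorem \<open>A\<close> has a spectral resolution,
  unique up to equality almost everywhere, so the union is over equal sets. For \<open>A\<close> nonnegative the
  resolution vanishes on the negative half-line, so values of \<open>\<phi>\<close> there play no role.\<close>

definition fun_calc :: "'a measure \<Rightarrow> (real \<Rightarrow> real) \<Rightarrow> 'a l2_op \<Rightarrow> 'a l2_op" where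
  "fun_calc m \<phi> A = \<Union> {spectral_integral m P \<phi> |P. spectral_resolution m A P}"

abbreviation op_sqrt :: "'a measure \<Rightarrow> 'a l2_op \<Rightarrow> 'a l2_op" where
  "op_sqrt m A \<equiv> fun_calc m sqrt A"

definition op_semigroup :: "'a measure \<Rightarrow> 'a l2_op \<Rightarrow> real \<Rightarrow> 'a l2_op" where
  "op_semigroup m L t = fun_calc m (\<lambda>l. exp (- t * l)) (op_neg L)"


section \<open>Forms and their generators\<close>

type_synonym 'a l2_form = "('a \<Rightarrow> real) \<Rightarrow> ('a \<Rightarrow> real) \<Rightarrow> real"

text \<open>The form with domain \<open>Domain (\<surd>(-L))\<close> and value \<open>\<langle>\<surd>(-L) f, \<surd>(-L) g\<rangle>\<close>. The choice of
  representatives of \<open>\<surd>(-L) f\<close> and \<open>\<surd>(-L) g\<close> does not affect the inner product.\<close>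

definition form_dom_of :: "'a measure \<Rightarrow> 'a l2_op \<Rightarrow> ('a \<Rightarrow> real) set" where
  "form_dom_of m L = Domain (op_sqrt m (op_neg L))"

definition form_of :: "'a measure \<Rightarrow> 'a l2_op \<Rightarrow> 'a l2_form" where
  "form_of m L f g =
     l2_inner m (SOME u. (f, u) \<in> op_sqrt m (op_neg L)) (SOME v. (g, v) \<in> op_sqrt m (op_neg L))"

text \<open>\<open>L\<close> is the non-positive self-adjoint operator associated with the closed form \<open>(a, D)\<close>.\<close>

definition form_generator ::
    "'a measure \<Rightarrow> ('a \<Rightarrow> real) set \<Rightarrow> 'a l2_form \<Rightarrow> 'a l2_op \<Rightarrow> bool" where
  "form_generator m D a L \<longleftrightarrow>
     self_adjoint m L \<and> nonpositive_op m L \<and>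
     D = form_dom_of m L \<and> (\<forall>f\<in>D. \<forall>g\<in>D. a f g = form_of m L f g)"

definition form1 :: "'a measure \<Rightarrow> 'a l2_form \<Rightarrow> 'a l2_form" where
  "form1 m a f g = a f g + l2_inner m f g"

definition form_cauchy :: "'a l2_form \<Rightarrow> (nat \<Rightarrow> 'a \<Rightarrow> real) \<Rightarrow> bool" where
  "form_cauchy a fs \<longleftrightarrow>
     (\<forall>e>0. \<exists>N. \<forall>i\<ge>N. \<forall>j\<ge>N. a (\<lambda>x. fs i x - fs j x) (\<lambda>x. fs i x - fs j x) < e)"

definition form_nonneg :: "('a \<Rightarrow> real) set \<Rightarrow> 'a l2_form \<Rightarrow> bool" where
  "form_nonneg D a \<longleftrightarrow> (\<forall>f\<in>D. 0 \<le> a f f)"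

definition symmetric_bilinear :: "'a measure \<Rightarrow> ('a \<Rightarrow> real) set \<Rightarrow> 'a l2_form \<Rightarrow> bool" where
  "symmetric_bilinear m D a \<longleftrightarrow>
     (\<forall>f\<in>D. \<forall>g\<in>D. a f g = a g f) \<and>
     (\<forall>f\<in>D. \<forall>g\<in>D. \<forall>h\<in>D. \<forall>c d. a (\<lambda>x. c * f x + d * g x) h = c * a f h + d * a g h) \<and>
     (\<forall>f\<in>D. \<forall>g\<in>D. \<forall>h\<in>D. (AE x in m. f x = g x) \<longrightarrow> a f h = a g h)"

definition form_closed :: "'a measure \<Rightarrow> ('a \<Rightarrow> real) set \<Rightarrow> 'a l2_form \<Rightarrow> bool" where
  "form_closed m D a \<longleftrightarrow>
     (\<forall>fs. (\<forall>n. fs n \<in> D) \<and> form_cauchy (form1 m a) fs \<longrightarrow>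
        (\<exists>f\<in>D. (\<lambda>n. form1 m a (\<lambda>x. fs n x - f x) (\<lambda>x. fs n x - f x)) \<longlonglongrightarrow> 0))"

definition form1_dense_in ::
    "'a measure \<Rightarrow> 'a l2_form \<Rightarrow> ('a \<Rightarrow> real) set \<Rightarrow> ('a \<Rightarrow> real) set \<Rightarrow> bool" where
  "form1_dense_in m a C D \<longleftrightarrow>
     (\<forall>f\<in>D. \<forall>e>0. \<exists>g\<in>C. form1 m a (\<lambda>x. f x - g x) (\<lambda>x. f x - g x) < e)"


section \<open>Dirichlet forms\<close>

definition dirichlet_form :: "'a measure \<Rightarrow> ('a \<Rightarrow> real) set \<Rightarrow> 'a l2_form \<Rightarrow> bool" where
  "dirichlet_form m D a \<longleftrightarrow>
     l2_subspace m D \<and> l2_dense m D \<and>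
     symmetric_bilinear m D a \<and> form_nonneg D a \<and> form_closed m D a \<and>
     (\<forall>f\<in>D. (\<lambda>x. min (max 0 (f x)) 1) \<in> D \<and>
        a (\<lambda>x. min (max 0 (f x)) 1) (\<lambda>x. min (max 0 (f x)) 1) \<le> a f f)"

text \<open>When \<open>m\<close> has full support, a class in \<open>L\<^sup>2\<close> has at most one continuous representative;
  \<open>D \<inter> Cc\<close> consists of the continuous representatives of elements of \<open>D\<close>.\<close>

definition Cc :: "('a::topological_space \<Rightarrow> real) set" where
  "Cc = {f. continuous_on UNIV f \<and> compact (closure {x. f x \<noteq> 0})}"

definition regular_form ::
    "'a::topological_space measure \<Rightarrow> ('a \<Rightarrow> real) set \<Rightarrow> 'a l2_form \<Rightarrow> bool" where
  "regular_form m D a \<longleftrightarrow>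
     form1_dense_in m a (D \<inter> Cc) D \<and>
     (\<forall>f\<in>Cc. \<forall>e>0. \<exists>g\<in>D \<inter> Cc. \<forall>x. \<bar>f x - g x\<bar> < e)"

definition irreducible_form :: "'a measure \<Rightarrow> ('a \<Rightarrow> real) set \<Rightarrow> 'a l2_form \<Rightarrow> bool" where
  "irreducible_form m D a \<longleftrightarrow>
     (\<exists>L. form_generator m D a L \<and>
        (\<forall>A\<in>sets m.
           (\<forall>t>0. \<forall>(f, h)\<in>op_semigroup m L t.
              (\<lambda>x. indicator A x * f x, \<lambda>x. indicator A x * h x) \<in> op_semigroup m L t) \<longrightarrow>
           emeasure m A = 0 \<or> emeasure m (space m - A) = 0))"


section \<open>Smooth measures\<close>

text \<open>On a locally compact separable metric space, a Borel measure finite on compact sets is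
  automatically regular.\<close>

definition radon_measure :: "'a::topological_space measure \<Rightarrow> bool" where
  "radon_measure \<mu> \<longleftrightarrow> sets \<mu> = sets borel \<and> (\<forall>K. compact K \<longrightarrow> emeasure \<mu> K < \<infinity>)"

definition full_support :: "'a::topological_space measure \<Rightarrow> bool" where
  "full_support m \<longleftrightarrow> (\<forall>U. open U \<and> U \<noteq> {} \<longrightarrow> emeasure m U > 0)"

definition nest ::
    "'a::topological_space measure \<Rightarrow> ('a \<Rightarrow> real) set \<Rightarrow> 'a l2_form \<Rightarrow> (nat \<Rightarrow> 'a set) \<Rightarrow> bool" where
  "nest m D a F \<longleftrightarrow>
     incseq F \<and> (\<forall>k. closed (F k)) \<and>
     form1_dense_in m a (\<Union>k. {f \<in> D. AE x in m. x \<notin> F k \<longrightarrow> f x = 0}) D"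

definition form_polar ::
    "'a::topological_space measure \<Rightarrow> ('a \<Rightarrow> real) set \<Rightarrow> 'a l2_form \<Rightarrow> 'a set \<Rightarrow> bool" where
  "form_polar m D a N \<longleftrightarrow> (\<exists>F. nest m D a F \<and> N \<subseteq> (\<Inter>k. - F k))"

text \<open>Polar sets need not be Borel, but each is contained in a Borel polar set.\<close>

definition smooth_measure ::
    "'a::topological_space measure \<Rightarrow> ('a \<Rightarrow> real) set \<Rightarrow> 'a l2_form \<Rightarrow> 'a measure \<Rightarrow> bool" where
  "smooth_measure m D a \<mu> \<longleftrightarrow>
     sets \<mu> = sets borel \<and>
     (\<forall>N\<in>sets borel. form_polar m D a N \<longrightarrow> emeasure \<mu> N = 0) \<and>
     (\<exists>F. nest m D a F \<and> (\<forall>k. emeasure \<mu> (F k) < \<infinity>))"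


section \<open>Schroedinger forms\<close>

text \<open>The signed measure \<open>\<mu> = \<mu>\<^sup>+ - \<mu>\<^sup>-\<close> is given by the pair \<open>\<mu>p\<close>, \<open>\<mu>n\<close>; its values may be
  undefined on sets of infinite measure.\<close>

definition schroedinger_form :: "'a l2_form \<Rightarrow> 'a measure \<Rightarrow> 'a measure \<Rightarrow> 'a l2_form" where
  "schroedinger_form a \<mu>p \<mu>n f g =
     a f g + (LINT x|\<mu>p. f x * g x) - (LINT x|\<mu>n. f x * g x)"

definition form_closable :: "'a measure \<Rightarrow> ('a \<Rightarrow> real) set \<Rightarrow> 'a l2_form \<Rightarrow> bool" where
  "form_closable m C a \<longleftrightarrow>
     (\<forall>fs. (\<forall>n. fs n \<in> C) \<and> form_cauchy a fs \<and> l2_tendsto m fs (\<lambda>x. 0) \<longrightarrow>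
        (\<lambda>n. a (fs n) (fs n)) \<longlonglongrightarrow> 0)"

definition form_approx ::
    "'a measure \<Rightarrow> ('a \<Rightarrow> real) set \<Rightarrow> 'a l2_form \<Rightarrow> ('a \<Rightarrow> real) \<Rightarrow> (nat \<Rightarrow> 'a \<Rightarrow> real) \<Rightarrow> bool" where
  "form_approx m C a f fs \<longleftrightarrow> (\<forall>n. fs n \<in> C) \<and> form_cauchy a fs \<and> l2_tendsto m fs f"

definition closure_dom :: "'a measure \<Rightarrow> ('a \<Rightarrow> real) set \<Rightarrow> 'a l2_form \<Rightarrow> ('a \<Rightarrow> real) set" where
  "closure_dom m C a = {f \<in> L2 m. \<exists>fs. form_approx m C a f fs}"

text \<open>The limit exists and does not depend on the approximating sequences when \<open>a\<close> is symmetric,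
  bilinear, nonnegative and closable on \<open>C\<close>.\<close>

definition closure_form :: "'a measure \<Rightarrow> ('a \<Rightarrow> real) set \<Rightarrow> 'a l2_form \<Rightarrow> 'a l2_form" where
  "closure_form m C a f g =
     (THE c. \<forall>fs gs. form_approx m C a f fs \<and> form_approx m C a g gs \<longrightarrow>
        (\<lambda>n. a (fs n) (gs n)) \<longlonglongrightarrow> c)"


section \<open>Bernstein functions and subordination\<close>

text \<open>Measures on \<open>(0,\<infinity>)\<close> are represented as Borel measures on the real line that do not charge the
  complement.\<close>

definition levy_measure :: "real measure \<Rightarrow> bool" where
  "levy_measure \<nu> \<longleftrightarrow>
     sets \<nu> = sets borel \<and> emeasure \<nu> {..0} = 0 \<and>
     (\<forall>K. compact K \<and> K \<subseteq> {0<..} \<longrightarrow> emeasure \<nu> K < \<infinity>) \<and>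
     (\<integral>\<^sup>+s. ennreal (min 1 s) \<partial>\<nu>) < \<infinity>"

definition bernstein :: "real \<Rightarrow> real measure \<Rightarrow> real \<Rightarrow> real" where
  "bernstein b \<nu> l = b * l + (LINT s|\<nu>. 1 - exp (- l * s))"

definition levy_support :: "real measure \<Rightarrow> real set" where
  "levy_support \<nu> = {s. 0 < s \<and> (\<forall>U. open U \<and> s \<in> U \<longrightarrow> emeasure \<nu> U > 0)}"

definition subordinate_op :: "'a measure \<Rightarrow> (real \<Rightarrow> real) \<Rightarrow> 'a l2_op \<Rightarrow> 'a l2_op" where
  "subordinate_op m \<Phi> L = op_neg (fun_calc m \<Phi> (op_neg L))"


section \<open>Extended spaces and subcriticality\<close>

definition ext_approx ::
    "'a measure \<Rightarrow> ('a \<Rightarrow> real) set \<Rightarrow> 'a l2_form \<Rightarrow> ('a \<Rightarrow> real) \<Rightarrow> (nat \<Rightarrow> 'a \<Rightarrow> real) \<Rightarrow> bool" where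
  "ext_approx m D a f fs \<longleftrightarrow>
     (\<forall>n. fs n \<in> D) \<and> form_cauchy a fs \<and> (AE x in m. (\<lambda>n. fs n x) \<longlonglongrightarrow> f x)"

definition extended_space ::
    "'a measure \<Rightarrow> ('a \<Rightarrow> real) set \<Rightarrow> 'a l2_form \<Rightarrow> ('a \<Rightarrow> real) set" where
  "extended_space m D a = {f \<in> borel_measurable m. \<exists>fs. ext_approx m D a f fs}"

text \<open>For \<open>f\<close> in the extended space \<open>a f f\<close> is the limit of \<open>a (fs n) (fs n)\<close>, which does not depend on
  the approximating sequence; the inequality is therefore stated for all of them. The left-hand side
  is an integral in \<open>[0,\<infinity>]\<close>, so that its finiteness is part of the claim.\<close>

definition subcritical :: "'a measure \<Rightarrow> ('a \<Rightarrow> real) set \<Rightarrow> 'a l2_form \<Rightarrow> bool" where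
  "subcritical m D a \<longleftrightarrow>
     (\<exists>g. (\<forall>x. 0 < g x) \<and> bounded (range g) \<and> integrable m g \<and>
        (\<forall>f\<in>extended_space m D a. \<forall>fs. ext_approx m D a f fs \<longrightarrow>
           (\<integral>\<^sup>+x. ennreal (\<bar>f x\<bar> * g x) \<partial>m) \<le> ennreal (sqrt (lim (\<lambda>n. a (fs n) (fs n))))))"

end

theory Submission
  imports Defs
begin

text \<open>Let \<open>A = -L\<^sup>\<mu>\<close>, with spectral measure \<open>P\<close>. Since \<open>\<Phi>\<close> does not vanish, \<open>\<Phi>(l) \<ge> c min(1, l)\<close> on
  \<open>[0, \<infinity>)\<close> for some \<open>c > 0\<close>. For \<open>f\<close> in the domain of the subordinated form split
  \<open>f = h + r\<close> with \<open>h = P[0,1] f\<close>. Subcriticality bounds \<open>\<integral> \<bar>h\<bar> g dm\<close> by the square root of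
  \<open>\<integral>\<^bsub>[0,1]\<^esub> l d\<langle>P f, f\<rangle>\<close>, and Cauchy-Schwarz bounds \<open>\<integral> \<bar>r\<bar> g dm\<close> by \<open>\<parallel>g\<parallel> \<parallel>r\<parallel>\<close>, where
  \<open>\<parallel>r\<parallel>\<^sup>2 = \<langle>P(1,\<infinity>) f, f\<rangle>\<close>. Both are at most a constant times the square root of
  \<open>\<integral> min(1, l) d\<langle>P f, f\<rangle> \<le> c\<^sup>-\<^sup>1 \<integral> \<Phi> d\<langle>P f, f\<rangle>\<close>. Fatou's lemma extends the bound to the extended space.\<close>

section \<open>Square-integrable functions\<close>

text \<open>The cut at 1 reflects how \<open>\<Phi>\<close> behaves. Near 0 it dominates a multiple
  of \<open>l\<close>, so the subordinated form controls the energy of \<open>h\<close> for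
  \<open>A\<close>, and subcriticality can be applied to \<open>h\<close>. For large
  \<open>l\<close> it may stay bounded, as for a finite \<open>\<nu>\<close> with
  \<open>b = 0\<close>; the energy of \<open>r\<close> is then out of reach and only its norm is
  controlled. This suffices because a bounded integrable weight \<open>g\<close> is
  square-integrable. The obstacle is that two spectral measures occur: the estimates use
  \<open>P\<close>, which resolves \<open>A\<close>, while the subordinated form is expressed by an
  arbitrary resolution \<open>Q\<close> of \<open>\<Phi>(A)\<close>. They are linked by the
  one-sided comparison \<open>\<integral> \<Phi> d\<langle>P f, f\<rangle> \<le> \<integral> l
  d\<langle>Q f, f\<rangle>\<close>, which follows from an inclusion of operator graphs by a
  variational inequality with cut-off trial vectors.\<close>

lemma L2_measurable [measurable_dest]: "f \<in> L2 m \<Longrightarrow> f \<in> borel_measurable m"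
  by (simp add: L2_def)

lemma L2_integrable_mult:
  assumes "f \<in> L2 m" "g \<in> L2 m"
  shows "integrable m (\<lambda>x. f x * g x)"
proof (rule Bochner_Integration.integrable_bound)
  show "integrable m (\<lambda>x. (f x)\<^sup>2 + (g x)\<^sup>2)"
    using assms by (auto simp: L2_def)
  have "\<bar>u * v\<bar> \<le> u\<^sup>2 + v\<^sup>2" for u v :: real
  proof -
    have "0 \<le> \<bar>u\<bar> * \<bar>v\<bar>"
      by simp
    then show ?thesis
      using sum_squares_bound[of "\<bar>u\<bar>" "\<bar>v\<bar>"] unfolding abs_mult power2_abs by linarith
  qed
  then show "AE x in m. norm (f x * g x) \<le> norm ((f x)\<^sup>2 + (g x)\<^sup>2)"
    by (auto intro!: AE_I2)
qed (use assms in measurable)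

lemma L2_scale:
  assumes "f \<in> L2 m"
  shows "(\<lambda>x. c * f x) \<in> L2 m"
  using assms by (auto simp: L2_def power_mult_distrib)

lemma L2_add:
  assumes "f \<in> L2 m" "g \<in> L2 m"
  shows "(\<lambda>x. f x + g x) \<in> L2 m"
proof -
  have "(f x + g x)\<^sup>2 = (f x)\<^sup>2 + 2 * (f x * g x) + (g x)\<^sup>2" for x
    by (simp add: power2_sum)
  then show ?thesis
    using assms L2_integrable_mult[OF assms] by (auto simp: L2_def)
qed

lemma L2_diff:
  assumes "f \<in> L2 m" "g \<in> L2 m"
  shows "(\<lambda>x. f x - g x) \<in> L2 m"
  using L2_add[OF assms(1) L2_scale[OF assms(2), of "-1"]] by simp

lemma L2_zero: "(\<lambda>x. 0) \<in> L2 m"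
  by (simp add: L2_def)

lemma L2_sum:
  assumes "\<And>i. i \<in> I \<Longrightarrow> f i \<in> L2 m"
  shows "(\<lambda>x. \<Sum>i\<in>I. f i x) \<in> L2 m"
  using assms by (induction I rule: infinite_finite_induct) (auto intro: L2_zero L2_add)

lemma L2_abs: "f \<in> L2 m \<Longrightarrow> (\<lambda>x. \<bar>f x\<bar>) \<in> L2 m"
  by (auto simp: L2_def)

text \<open>From \<open>g\<^sup>2 \<le> K \<bar>g\<bar>\<close>. Applied to the weight of
  subcriticality, it lets Cauchy-Schwarz handle the part of a function at high spectral
  values.\<close>

lemma L2_bounded_integrable:
  assumes "integrable m g" "bounded (range g)"
  shows "g \<in> L2 m"
proof -
  obtain K where K: "\<And>x. \<bar>g x\<bar> \<le> K"
    using assms(2) by (auto simp: bounded_iff)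
  have "integrable m (\<lambda>x. (g x)\<^sup>2)"
  proof (rule Bochner_Integration.integrable_bound)
    show "integrable m (\<lambda>x. K * \<bar>g x\<bar>)"
      using assms(1) by simp
    show "AE x in m. norm ((g x)\<^sup>2) \<le> norm (K * \<bar>g x\<bar>)"
    proof (rule AE_I2)
      fix x
      have "(g x)\<^sup>2 = \<bar>g x\<bar> * \<bar>g x\<bar>"
        by (simp add: power2_eq_square)
      also have "\<dots> \<le> K * \<bar>g x\<bar>"
        using K by (intro mult_right_mono) auto
      finally show "norm ((g x)\<^sup>2) \<le> norm (K * \<bar>g x\<bar>)"
        by simp
    qed
  qed (use assms in measurable)
  then show ?thesis
    using assms by (auto simp: L2_def)
qed

lemma l2_inner_commute: "l2_inner m f g = l2_inner m g f"
  by (simp add: l2_inner_def mult.commute)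

lemma l2_inner_add_left:
  assumes "f \<in> L2 m" "g \<in> L2 m" "h \<in> L2 m"
  shows "l2_inner m (\<lambda>x. f x + g x) h = l2_inner m f h + l2_inner m g h"
  using assms by (simp add: l2_inner_def distrib_right L2_integrable_mult)

lemma l2_inner_diff_left:
  assumes "f \<in> L2 m" "g \<in> L2 m" "h \<in> L2 m"
  shows "l2_inner m (\<lambda>x. f x - g x) h = l2_inner m f h - l2_inner m g h"
  using assms by (simp add: l2_inner_def left_diff_distrib L2_integrable_mult)

lemma l2_inner_add_right:
  assumes "f \<in> L2 m" "g \<in> L2 m" "h \<in> L2 m"
  shows "l2_inner m h (\<lambda>x. f x + g x) = l2_inner m h f + l2_inner m h g"
  using l2_inner_add_left[OF assms] by (simp add: l2_inner_commute)

lemma l2_inner_diff_right: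
  assumes "f \<in> L2 m" "g \<in> L2 m" "h \<in> L2 m"
  shows "l2_inner m h (\<lambda>x. f x - g x) = l2_inner m h f - l2_inner m h g"
  using l2_inner_diff_left[OF assms] by (simp add: l2_inner_commute)

lemma l2_inner_scale_left: "l2_inner m (\<lambda>x. c * f x) h = c * l2_inner m f h"
  by (simp add: l2_inner_def mult.assoc)

lemma l2_inner_scale_right: "l2_inner m h (\<lambda>x. c * f x) = c * l2_inner m h f"
  by (metis l2_inner_commute l2_inner_scale_left)

lemma l2_inner_uminus_left: "l2_inner m (\<lambda>x. - f x) h = - l2_inner m f h"
  by (simp add: l2_inner_def)

lemma l2_inner_zero_left: "l2_inner m (\<lambda>x. 0) h = 0"
  by (simp add: l2_inner_def)

lemma l2_inner_sum_left:
  assumes "\<And>i. i \<in> I \<Longrightarrow> f i \<in> L2 m" "h \<in> L2 m"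
  shows "l2_inner m (\<lambda>x. \<Sum>i\<in>I. f i x) h = (\<Sum>i\<in>I. l2_inner m (f i) h)"
  using assms
  by (induction I rule: infinite_finite_induct)
    (auto simp: l2_inner_zero_left l2_inner_add_left L2_sum)

lemma l2_inner_cong_AE:
  assumes "AE x in m. f x = f' x" "f \<in> L2 m" "f' \<in> L2 m" "g \<in> L2 m"
  shows "l2_inner m f g = l2_inner m f' g"
  unfolding l2_inner_def using assms by (intro integral_cong_AE) auto

lemma l2_inner_nonneg: "0 \<le> l2_inner m f f"
  by (simp add: l2_inner_def)

lemma l2_inner_self_eq_0:
  assumes "f \<in> L2 m" "l2_inner m f f = 0"
  shows "AE x in m. f x = 0"
  using assms integral_nonneg_eq_0_iff_AE[of m "\<lambda>x. f x * f x"]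
  by (simp add: l2_inner_def L2_integrable_mult)

section \<open>Cauchy-Schwarz and continuity of the inner product\<close>

lemma l2_Cauchy_Schwarz:
  assumes f: "f \<in> L2 m" and g: "g \<in> L2 m"
  shows "\<bar>l2_inner m f g\<bar> \<le> sqrt (l2_inner m f f) * sqrt (l2_inner m g g)"
proof -
  let ?F = "l2_inner m f f" and ?G = "l2_inner m g g" and ?c = "l2_inner m f g"
  have *: "0 \<le> s\<^sup>2 * ?F - 2 * s * t * ?c + t\<^sup>2 * ?G" for s t
  proof -
    let ?h = "\<lambda>x. s * f x - t * g x"
    have "l2_inner m ?h ?h = s\<^sup>2 * ?F - 2 * s * t * ?c + t\<^sup>2 * ?G"
      using f g by (simp add: l2_inner_diff_left l2_inner_diff_right L2_scale L2_diff
          l2_inner_scale_left l2_inner_scale_right l2_inner_commute[of m g f]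
          power2_eq_square algebra_simps)
    then show ?thesis
      using l2_inner_nonneg[of m ?h] by simp
  qed
  have "?c\<^sup>2 \<le> ?F * ?G"
  proof (cases "?G = 0")
    case True
    have "?c = 0"
    proof (rule ccontr)
      assume "?c \<noteq> 0"
      \<comment> \<open>With these values of \<open>s\<close> and \<open>t\<close> the nonnegative
        expression equals \<open>?F - (?F + 1) = - 1\<close>.\<close>
      then show False
        using *[of 1 "(?F + 1) / (2 * ?c)"] True l2_inner_nonneg[of m f] by (simp add: field_simps)
    qed
    then show ?thesis
      by (simp add: l2_inner_nonneg)
  next
    case False
    then have G: "0 < ?G"
      using l2_inner_nonneg[of m g] by simp
    \<comment> \<open>Up to scaling, \<open>s = ?G\<close> and \<open>t = ?c\<close> subtract from
      \<open>f\<close> its projection onto \<open>g\<close>.\<close>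
    have "0 \<le> ?G * (?G * ?F - ?c\<^sup>2)"
      using *[of ?G ?c] by (simp add: power2_eq_square algebra_simps)
    then show ?thesis
      using G by (simp add: zero_le_mult_iff mult.commute)
  qed
  then show ?thesis
    by (metis real_sqrt_abs real_sqrt_le_mono real_sqrt_mult)
qed

lemma l2_tendsto_iff_inner:
  "l2_tendsto m fs f \<longleftrightarrow> (\<lambda>n. l2_inner m (\<lambda>x. fs n x - f x) (\<lambda>x. fs n x - f x)) \<longlonglongrightarrow> 0"
  by (simp add: l2_tendsto_def l2_inner_def power2_eq_square)

lemma l2_tendsto_inner_left:
  assumes lim: "l2_tendsto m fs f" and L2: "\<And>n. fs n \<in> L2 m" "f \<in> L2 m" "g \<in> L2 m"
  shows "(\<lambda>n. l2_inner m (fs n) g) \<longlonglongrightarrow> l2_inner m f g"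
proof -
  let ?d = "\<lambda>n x. fs n x - f x"
  have "(\<lambda>n. sqrt (l2_inner m (?d n) (?d n)) * sqrt (l2_inner m g g)) \<longlonglongrightarrow> sqrt 0 * sqrt (l2_inner m g g)"
    using lim unfolding l2_tendsto_iff_inner by (intro tendsto_intros)
  then have lim0: "(\<lambda>n. sqrt (l2_inner m (?d n) (?d n)) * sqrt (l2_inner m g g)) \<longlonglongrightarrow> 0"
    by simp
  have "(\<lambda>n. l2_inner m (?d n) g) \<longlonglongrightarrow> 0"
  proof (rule Lim_null_comparison[OF always_eventually lim0], rule allI)
    show "norm (l2_inner m (?d n) g) \<le> sqrt (l2_inner m (?d n) (?d n)) * sqrt (l2_inner m g g)" for n
      unfolding real_norm_def by (rule l2_Cauchy_Schwarz[OF L2_diff[OF L2(1) L2(2)] L2(3)])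
  qed
  then show ?thesis
    unfolding l2_inner_diff_left[OF L2] by (rule LIM_zero_cancel)
qed

lemma l2_tendsto_inner_self:
  assumes lim: "l2_tendsto m fs f" and L2: "\<And>n. fs n \<in> L2 m" "f \<in> L2 m"
  shows "(\<lambda>n. l2_inner m (fs n) (fs n)) \<longlonglongrightarrow> l2_inner m f f"
proof -
  let ?d = "\<lambda>n x. fs n x - f x"
  have "l2_inner m (fs n) (fs n) = l2_inner m (?d n) (?d n) + 2 * l2_inner m (fs n) f - l2_inner m f f" for n
    using L2 by (simp add: l2_inner_diff_left l2_inner_diff_right L2_diff l2_inner_commute[of m f "fs n"])
  moreover have "(\<lambda>n. l2_inner m (?d n) (?d n) + 2 * l2_inner m (fs n) f - l2_inner m f f)
      \<longlonglongrightarrow> 0 + 2 * l2_inner m f f - l2_inner m f f"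
    using lim l2_tendsto_inner_left[OF lim L2 L2(2)] unfolding l2_tendsto_iff_inner
    by (intro tendsto_intros)
  ultimately show ?thesis
    by simp
qed

lemma nn_integral_square_L2:
  assumes "f \<in> L2 m"
  shows "(\<integral>\<^sup>+x. ennreal ((f x)\<^sup>2) \<partial>m) = ennreal (l2_inner m f f)"
  using assms by (subst nn_integral_eq_integral) (auto simp: L2_def l2_inner_def power2_eq_square)

text \<open>Along a subsequence with \<open>\<parallel>d\<^sub>k\<parallel>\<^sup>2 \<le> 4\<^sup>-\<^sup>k\<close> for the increments \<open>d\<^sub>k\<close>, the function
  \<open>\<Sum>k. 2\<^sup>k d\<^sub>k\<^sup>2\<close> is integrable, and \<open>\<bar>d\<^sub>k\<bar> \<le> 2\<^sup>-\<^sup>k + 2\<^sup>k d\<^sub>k\<^sup>2\<close> gives convergence almost everywhere.\<close>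

lemma L2_complete:
  assumes L2: "\<And>n. fs n \<in> L2 m"
    and cauchy: "\<And>e. 0 < e \<Longrightarrow> \<exists>N. \<forall>i\<ge>N. \<forall>j\<ge>N. l2_inner m (\<lambda>x. fs i x - fs j x) (\<lambda>x. fs i x - fs j x) < e"
  obtains f where "f \<in> L2 m" "l2_tendsto m fs f"
proof -
  note [measurable] = L2[THEN L2_measurable]
  have "\<forall>k. \<exists>N. \<forall>i\<ge>N. \<forall>j\<ge>N. l2_inner m (\<lambda>x. fs i x - fs j x) (\<lambda>x. fs i x - fs j x) < (1/4)^k"
    using cauchy by simp
  then obtain N where N: "\<And>k i j. N k \<le> i \<Longrightarrow> N k \<le> j \<Longrightarrow>
      l2_inner m (\<lambda>x. fs i x - fs j x) (\<lambda>x. fs i x - fs j x) < (1/4)^k"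
    by metis
  \<comment> \<open>Summing the thresholds puts \<open>r k\<close> beyond every \<open>N j\<close>
    with \<open>j \<le> k\<close>.\<close>
  define r where "r k = (\<Sum>i\<le>k. N i)" for k
  have rN: "N j \<le> r k" if "j \<le> k" for j k
    unfolding r_def using that by (intro member_le_sum) auto
  define d where "d k x = fs (r (Suc k)) x - fs (r k) x" for k x
  have d_L2: "d k \<in> L2 m" for k
    unfolding d_def by (intro L2_diff L2)
  note [measurable] = d_L2[THEN L2_measurable]
  have d_le: "l2_inner m (d k) (d k) \<le> (1/4)^k" for k
    unfolding d_def using N[of k "r (Suc k)" "r k"] rN by (simp add: less_imp_le)
  have "(\<integral>\<^sup>+x. (\<Sum>k. ennreal (2^k * (d k x)\<^sup>2)) \<partial>m) = (\<Sum>k. \<integral>\<^sup>+x. ennreal (2^k * (d k x)\<^sup>2) \<partial>m)"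
    by (rule nn_integral_suminf) measurable
  also have "\<dots> \<le> (\<Sum>k. ennreal ((1/2)^k))"
  proof (rule suminf_le)
    fix k
    have "(\<integral>\<^sup>+x. ennreal (2^k * (d k x)\<^sup>2) \<partial>m) = ennreal (2^k) * (\<integral>\<^sup>+x. ennreal ((d k x)\<^sup>2) \<partial>m)"
      by (subst nn_integral_cmult[symmetric]) (auto simp: ennreal_mult)
    also have "\<dots> = ennreal (2^k * l2_inner m (d k) (d k))"
      by (simp add: nn_integral_square_L2[OF d_L2] ennreal_mult l2_inner_nonneg)
    also have "\<dots> \<le> ennreal (2^k * (1/4)^k)"
      using d_le by (intro ennreal_leI mult_left_mono) auto
    also have "2^k * (1/4::real)^k = (1/2)^k"
      by (simp flip: power_mult_distrib)
    finally show "(\<integral>\<^sup>+x. ennreal (2^k * (d k x)\<^sup>2) \<partial>m) \<le> ennreal ((1/2)^k)" .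
  qed auto
  also have "\<dots> = ennreal (\<Sum>k. (1/2)^k)"
    by (intro suminf_ennreal2) (auto intro: summable_geometric)
  finally have "(\<integral>\<^sup>+x. (\<Sum>k. ennreal (2^k * (d k x)\<^sup>2)) \<partial>m) \<noteq> \<infinity>"
    by (auto simp: top_unique)
  then have "AE x in m. (\<Sum>k. ennreal (2^k * (d k x)\<^sup>2)) \<noteq> \<infinity>"
    by (intro nn_integral_noteq_infinite) auto
  then have AE_conv: "AE x in m. convergent (\<lambda>k. fs (r k) x)"
  proof eventually_elim
    case (elim x)
    have s1: "summable (\<lambda>k. 2^k * (d k x)\<^sup>2)"
      using elim by (intro summable_suminf_not_top) auto
    have s2: "summable (\<lambda>k. (1/2)^k + 2^k * (d k x)\<^sup>2)"
      by (intro summable_add s1 summable_geometric) auto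
    have "\<bar>d k x\<bar> \<le> (1/2)^k + 2^k * (d k x)\<^sup>2" for k
    proof -
      have "\<bar>y\<bar> \<le> 1 / t + t * y\<^sup>2" if "0 < t" for y t :: real
      proof -
        have "0 \<le> (t * \<bar>y\<bar> - 1)\<^sup>2 + t * \<bar>y\<bar>"
          using that by (intro add_nonneg_nonneg mult_nonneg_nonneg) auto
        then show ?thesis
          using that by (simp add: power2_eq_square field_simps)
      qed
      from this[of "2^k" "d k x"] show ?thesis
        by (simp add: power_one_over)
    qed
    then have "summable (\<lambda>k. d k x)"
      by (intro summable_comparison_test'[OF s2, of 0]) auto
    then have "convergent (\<lambda>n. \<Sum>k<n. d k x)"
      by (simp add: summable_iff_convergent)
    then have "convergent (\<lambda>n. (\<Sum>k<n. d k x) + fs (r 0) x)"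
      by (intro convergent_add convergent_const)
    moreover have "(\<Sum>k<n. d k x) + fs (r 0) x = fs (r n) x" for n
      unfolding d_def by (induction n) auto
    ultimately show ?case
      by simp
  qed
  define f where "f x = lim (\<lambda>k. fs (r k) x)" for x
  have [measurable]: "f \<in> borel_measurable m"
    unfolding f_def by measurable
  \<comment> \<open>Fatou's lemma along the subsequence turns the Cauchy estimate into one against
    the limit, for every large index \<open>j\<close> and not only along \<open>r\<close>.\<close>
  have bound: "(\<integral>\<^sup>+x. ennreal ((fs j x - f x)\<^sup>2) \<partial>m) \<le> ennreal ((1/4)^k)" if "N k \<le> j" for j k
  proof -
    have "(\<integral>\<^sup>+x. ennreal ((fs j x - f x)\<^sup>2) \<partial>m) \<le> (\<integral>\<^sup>+x. liminf (\<lambda>i. ennreal ((fs j x - fs (r i) x)\<^sup>2)) \<partial>m)"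
    proof (rule nn_integral_mono_AE, use AE_conv in eventually_elim)
      case (elim x)
      then have "(\<lambda>i. fs (r i) x) \<longlonglongrightarrow> f x"
        by (simp add: f_def convergent_LIMSEQ_iff)
      then have "(\<lambda>i. ennreal ((fs j x - fs (r i) x)\<^sup>2)) \<longlonglongrightarrow> ennreal ((fs j x - f x)\<^sup>2)"
        by (intro tendsto_intros)
      from lim_imp_Liminf[OF sequentially_bot this] show ?case
        by (rule eq_refl[OF sym])
    qed
    also have "\<dots> \<le> liminf (\<lambda>i. \<integral>\<^sup>+x. ennreal ((fs j x - fs (r i) x)\<^sup>2) \<partial>m)"
      by (intro nn_integral_liminf) measurable
    also have "\<dots> \<le> limsup (\<lambda>i. \<integral>\<^sup>+x. ennreal ((fs j x - fs (r i) x)\<^sup>2) \<partial>m)"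
      by (intro Liminf_le_Limsup) simp
    also have "\<dots> \<le> ennreal ((1/4)^k)"
    proof (rule Limsup_bounded, rule eventually_sequentiallyI)
      fix i assume "k \<le> i"
      then have "l2_inner m (\<lambda>x. fs j x - fs (r i) x) (\<lambda>x. fs j x - fs (r i) x) \<le> (1/4)^k"
        using N[of k j "r i"] that rN by (simp add: less_imp_le)
      then show "(\<integral>\<^sup>+x. ennreal ((fs j x - fs (r i) x)\<^sup>2) \<partial>m) \<le> ennreal ((1/4)^k)"
        using nn_integral_square_L2[OF L2_diff[OF L2 L2, of j "r i"]] by (simp add: ennreal_leI)
    qed
    finally show ?thesis .
  qed
  have diff_L2: "(\<lambda>x. fs j x - f x) \<in> L2 m" if "N k \<le> j" for j k
  proof -
    have "integrable m (\<lambda>x. (fs j x - f x)\<^sup>2)"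
      by (rule integrableI_nonneg)
        (use bound[OF that] in \<open>auto intro: le_less_trans ennreal_less_top\<close>)
    then show ?thesis
      by (simp add: L2_def)
  qed
  have f_L2: "f \<in> L2 m"
    using L2_diff[OF L2 diff_L2[of 0 "N 0"], of "N 0"] by simp
  have "l2_tendsto m fs f"
    unfolding l2_tendsto_iff_inner
  proof (rule LIMSEQ_I)
    fix e :: real assume "0 < e"
    then obtain k where k: "(1/4)^k < e"
      using real_arch_pow_inv[of e "1/4"] by auto
    have "norm (l2_inner m (\<lambda>x. fs j x - f x) (\<lambda>x. fs j x - f x) - 0) < e" if "N k \<le> j" for j
      using bound[OF that] nn_integral_square_L2[OF diff_L2[OF that]] k
        l2_inner_nonneg[of m "\<lambda>x. fs j x - f x"]
      by (simp add: ennreal_le_iff)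
    then show "\<exists>n0. \<forall>n\<ge>n0. norm (l2_inner m (\<lambda>x. fs n x - f x) (\<lambda>x. fs n x - f x) - 0) < e"
      by blast
  qed
  with f_L2 show thesis
    by (rule that)
qed

section \<open>Spectral measures\<close>

text \<open>Induction over measurable functions, starting from indicators. Two measures stand on
  each side because the parallelogram law for scalar measures compares sums; a null measure on the
  left gives bounds for a single measure.\<close>

lemma nn_integral_add_measures_le:
  assumes sets: "sets M1 = sets N" "sets M2 = sets N" "sets N1 = sets N" "sets N2 = sets N"
    and le: "\<And>A. A \<in> sets N \<Longrightarrow>
      emeasure M1 A + emeasure M2 A \<le> c1 * emeasure N1 A + c2 * emeasure N2 A"
    and "\<phi> \<in> borel_measurable N"
  shows "(\<integral>\<^sup>+x. \<phi> x \<partial>M1) + (\<integral>\<^sup>+x. \<phi> x \<partial>M2) \<le> c1 * (\<integral>\<^sup>+x. \<phi> x \<partial>N1) + c2 * (\<integral>\<^sup>+x. \<phi> x \<partial>N2)"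
proof -
  have meas: "borel_measurable M1 = borel_measurable N" "borel_measurable M2 = borel_measurable N"
    "borel_measurable N1 = borel_measurable N" "borel_measurable N2 = borel_measurable N"
    using sets by (auto intro!: measurable_cong_sets)
  note space = sets[THEN sets_eq_imp_space_eq]
  from \<open>\<phi> \<in> borel_measurable N\<close> show ?thesis
  proof (induction \<phi> rule: borel_measurable_induct)
    case (cong f g)
    have "(\<integral>\<^sup>+x. f x \<partial>K) = (\<integral>\<^sup>+x. g x \<partial>K)" if "space K = space N" for K
      using cong that by (intro nn_integral_cong) auto
    then show ?case
      using cong space by simp
  next
    case (set A)
    then show ?case
      using le sets by simp
  next
    case (mult u c)
    have "c * ((\<integral>\<^sup>+x. u x \<partial>M1) + (\<integral>\<^sup>+x. u x \<partial>M2)) \<le>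
        c * (c1 * (\<integral>\<^sup>+x. u x \<partial>N1) + c2 * (\<integral>\<^sup>+x. u x \<partial>N2))"
      by (intro mult_left_mono mult.IH) simp
    then show ?case
      using mult by (simp add: nn_integral_cmult meas distrib_left mult.left_commute)
  next
    case (add u v)
    then show ?case
      using add_mono[OF add.IH] by (simp add: nn_integral_add meas distrib_left ac_simps)
  next
    case (seq U)
    have eq: "(\<integral>\<^sup>+x. (SUP i. U i) x \<partial>K) = (SUP i. \<integral>\<^sup>+x. U i x \<partial>K)"
      if "borel_measurable K = (borel_measurable N :: ('a \<Rightarrow> ennreal) set)" for K
      unfolding SUP_apply using seq that by (intro nn_integral_monotone_convergence_SUP) auto
    have inc: "incseq (\<lambda>i. \<integral>\<^sup>+x. U i x \<partial>K)" for K
      using \<open>incseq U\<close> by (auto simp: incseq_def le_fun_def intro!: nn_integral_mono)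
    have "(SUP i. (\<integral>\<^sup>+x. U i x \<partial>M1) + (\<integral>\<^sup>+x. U i x \<partial>M2)) \<le>
        c1 * (SUP i. \<integral>\<^sup>+x. U i x \<partial>N1) + c2 * (SUP i. \<integral>\<^sup>+x. U i x \<partial>N2)"
      by (intro SUP_least order_trans[OF seq.IH] add_mono mult_left_mono SUP_upper) auto
    then show ?case
      unfolding eq[OF meas(1)] eq[OF meas(2)] eq[OF meas(3)] eq[OF meas(4)]
      by (simp add: ennreal_SUP_add inc)
  qed
qed

locale projection_measure =
  fixes m :: "'a measure" and P :: "real set \<Rightarrow> ('a \<Rightarrow> real) \<Rightarrow> ('a \<Rightarrow> real)"
  assumes spectral_measure: "spectral_measure m P"
begin

abbreviation "M \<equiv> scalar_measure m P"

section \<open>Algebra of the projections\<close>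

lemma proj_L2: "B \<in> sets borel \<Longrightarrow> f \<in> L2 m \<Longrightarrow> P B f \<in> L2 m"
  using spectral_measure by (simp add: spectral_measure_def)

lemma proj_symmetric:
  "B \<in> sets borel \<Longrightarrow> f \<in> L2 m \<Longrightarrow> g \<in> L2 m \<Longrightarrow> l2_inner m (P B f) g = l2_inner m f (P B g)"
  using spectral_measure by (simp add: spectral_measure_def)

text \<open>The composition law holds only almost everywhere. Testing it against \<open>g\<close>
  gives an equation between real numbers, which can be used for rewriting.\<close>

lemma proj_proj:
  assumes "B \<in> sets borel" "C \<in> sets borel" "f \<in> L2 m" "g \<in> L2 m"
  shows "l2_inner m (P B (P C f)) g = l2_inner m (P (B \<inter> C) f) g"
  using assms spectral_measure
  by (intro l2_inner_cong_AE) (auto intro!: proj_L2 simp: spectral_measure_def)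

lemma proj_UNIV: "f \<in> L2 m \<Longrightarrow> g \<in> L2 m \<Longrightarrow> l2_inner m (P UNIV f) g = l2_inner m f g"
  using spectral_measure
  by (intro l2_inner_cong_AE) (auto intro!: proj_L2 simp: spectral_measure_def)

lemma inner_proj_proj:
  assumes "B \<in> sets borel" "C \<in> sets borel" "f \<in> L2 m" "g \<in> L2 m"
  shows "l2_inner m (P B f) (P C g) = l2_inner m (P (B \<inter> C) f) g"
  using assms proj_symmetric[of C "P B f" g] proj_proj[of C B f g]
  by (simp add: proj_L2 Int_commute)

text \<open>Linearity of \<open>P B\<close> comes from symmetry: once \<open>P B\<close> is moved to
  \<open>h\<close>, only additivity of the inner product remains.\<close>

lemma proj_add:
  assumes "B \<in> sets borel" "f \<in> L2 m" "g \<in> L2 m" "h \<in> L2 m"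
  shows "l2_inner m (P B (\<lambda>x. f x + g x)) h = l2_inner m (P B f) h + l2_inner m (P B g) h"
  using assms by (simp add: proj_symmetric L2_add l2_inner_add_left proj_L2)

lemma proj_diff:
  assumes "B \<in> sets borel" "f \<in> L2 m" "g \<in> L2 m" "h \<in> L2 m"
  shows "l2_inner m (P B (\<lambda>x. f x - g x)) h = l2_inner m (P B f) h - l2_inner m (P B g) h"
  using assms by (simp add: proj_symmetric L2_diff l2_inner_diff_left proj_L2)

lemma proj_scale:
  assumes "B \<in> sets borel" "f \<in> L2 m" "h \<in> L2 m"
  shows "l2_inner m (P B (\<lambda>x. c * f x)) h = c * l2_inner m (P B f) h"
  using assms by (simp add: proj_symmetric L2_scale l2_inner_scale_left proj_L2)

lemma proj_inner_self: "B \<in> sets borel \<Longrightarrow> f \<in> L2 m \<Longrightarrow> l2_inner m (P B f) f = l2_inner m (P B f) (P B f)"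
  by (simp add: inner_proj_proj)

lemma proj_inner_nonneg: "B \<in> sets borel \<Longrightarrow> f \<in> L2 m \<Longrightarrow> 0 \<le> l2_inner m (P B f) f"
  by (simp add: proj_inner_self l2_inner_nonneg)

lemma proj_sums:
  assumes B: "range B \<subseteq> sets borel" "disjoint_family B" and f: "f \<in> L2 m"
  shows "(\<lambda>i. l2_inner m (P (B i) f) f) sums l2_inner m (P (\<Union>i. B i) f) f"
proof -
  have L2: "P (B i) f \<in> L2 m" for i
    using B f by (intro proj_L2) auto
  have "l2_tendsto m (\<lambda>n x. \<Sum>i<n. P (B i) f x) (P (\<Union>i. B i) f)"
    using spectral_measure B f by (simp add: spectral_measure_def)
  then have "(\<lambda>n. l2_inner m (\<lambda>x. \<Sum>i<n. P (B i) f x) f) \<longlonglongrightarrow> l2_inner m (P (\<Union>i. B i) f) f"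
    using B f by (intro l2_tendsto_inner_left L2_sum L2 proj_L2) auto
  then show ?thesis
    by (simp add: sums_def l2_inner_sum_left L2 f)
qed

section \<open>Scalar measures and their polarization\<close>

lemma sets_scalar_measure [simp, measurable_cong]: "sets (M f) = sets borel"
  using sets.sigma_sets_eq[of "borel :: real measure"] by (simp add: scalar_measure_def sets_measure_of)

lemma space_scalar_measure [simp]: "space (M f) = UNIV"
  by (simp add: scalar_measure_def space_measure_of_conv)

lemma emeasure_scalar_measure:
  assumes B: "B \<in> sets borel" and f: "f \<in> L2 m"
  shows "emeasure (M f) B = ennreal (l2_inner m (P B f) f)"
  unfolding scalar_measure_def
proof (rule emeasure_measure_of_sigma)
  show "sigma_algebra UNIV (sets (borel :: real measure))"
    using sets.sigma_algebra_axioms[of "borel :: real measure"] by simp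
  \<comment> \<open>The empty set is a disjoint union of countably many copies of itself, and a
    summable constant sequence is 0.\<close>
  have "(\<lambda>i::nat. l2_inner m (P {} f) f) sums l2_inner m (P {} f) f"
    using proj_sums[of "\<lambda>i. {}" f] f by (simp add: disjoint_family_on_def)
  then have "(\<lambda>i::nat. l2_inner m (P {} f) f) \<longlonglongrightarrow> 0"
    by (intro summable_LIMSEQ_zero sums_summable)
  then have "l2_inner m (P {} f) f = 0"
    by (simp add: LIMSEQ_const_iff)
  then show "positive (sets borel) (\<lambda>B. ennreal (l2_inner m (P B f) f))"
    by (simp add: positive_def)
  show "countably_additive (sets borel) (\<lambda>B. ennreal (l2_inner m (P B f) f))"
  proof (rule countably_additiveI)
    fix A :: "nat \<Rightarrow> real set"
    assume A: "range A \<subseteq> sets borel" "disjoint_family A" "(\<Union>i. A i) \<in> sets borel"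
    have "0 \<le> l2_inner m (P (A i) f) f" for i
      using A f by (intro proj_inner_nonneg) auto
    then have "(\<lambda>i. ennreal (l2_inner m (P (A i) f) f)) sums ennreal (l2_inner m (P (\<Union>i. A i) f) f)"
      using proj_sums[OF A(1,2) f] A f by (subst sums_ennreal) (auto intro: proj_inner_nonneg)
    then show "(\<Sum>i. ennreal (l2_inner m (P (A i) f) f)) = ennreal (l2_inner m (P (\<Union>i. A i) f) f)"
      by (simp add: sums_iff)
  qed
qed (use B in simp)

lemma finite_scalar_measure: "f \<in> L2 m \<Longrightarrow> finite_measure (M f)"
  by (rule finite_measureI) (simp add: emeasure_scalar_measure)

lemma measure_scalar_measure:
  "B \<in> sets borel \<Longrightarrow> f \<in> L2 m \<Longrightarrow> measure (M f) B = l2_inner m (P B f) f"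
  by (simp add: measure_def emeasure_scalar_measure proj_inner_nonneg)

lemma proj_polar_commute:
  assumes "B \<in> sets borel" "f \<in> L2 m" "g \<in> L2 m"
  shows "l2_inner m (P B g) f = l2_inner m (P B f) g"
  using assms by (simp add: proj_symmetric l2_inner_commute[of m g])

lemma measure_scalar_measure_add:
  assumes "B \<in> sets borel" "f \<in> L2 m" "g \<in> L2 m"
  shows "measure (M (\<lambda>x. f x + g x)) B
    = measure (M f) B + measure (M g) B + 2 * l2_inner m (P B f) g"
  using assms proj_polar_commute[OF assms]
  by (simp add: measure_scalar_measure L2_add proj_add l2_inner_add_right proj_L2)

lemma measure_scalar_measure_diff:
  assumes "B \<in> sets borel" "f \<in> L2 m" "g \<in> L2 m"
  shows "measure (M (\<lambda>x. f x - g x)) B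
    = measure (M f) B + measure (M g) B - 2 * l2_inner m (P B f) g"
  using assms proj_polar_commute[OF assms]
  by (simp add: measure_scalar_measure L2_diff proj_diff l2_inner_diff_right proj_L2)

lemma emeasure_eq_measure: "f \<in> L2 m \<Longrightarrow> emeasure (M f) B = ennreal (measure (M f) B)"
  by (rule finite_measure.emeasure_eq_measure[OF finite_scalar_measure])

text \<open>The mixed terms cancel on each Borel set. Since the integrals may be infinite, one
  inequality settles at once that sum and difference stay in a domain and how their forms
  compare.\<close>

lemma nn_integral_parallelogram:
  assumes "f \<in> L2 m" "g \<in> L2 m" and [measurable]: "\<phi> \<in> borel_measurable borel"
  shows "(\<integral>\<^sup>+l. \<phi> l \<partial>M (\<lambda>x. f x + g x)) + (\<integral>\<^sup>+l. \<phi> l \<partial>M (\<lambda>x. f x - g x))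
    \<le> 2 * (\<integral>\<^sup>+l. \<phi> l \<partial>M f) + 2 * (\<integral>\<^sup>+l. \<phi> l \<partial>M g)"
proof (rule nn_integral_add_measures_le[where N = borel])
  fix A :: "real set" assume "A \<in> sets borel"
  then have "measure (M (\<lambda>x. f x + g x)) A + measure (M (\<lambda>x. f x - g x)) A
      = 2 * measure (M f) A + 2 * measure (M g) A"
    using assms by (simp add: measure_scalar_measure_add measure_scalar_measure_diff)
  then show "emeasure (M (\<lambda>x. f x + g x)) A + emeasure (M (\<lambda>x. f x - g x)) A
      \<le> 2 * emeasure (M f) A + 2 * emeasure (M g) A"
    using assms
    by (simp add: emeasure_eq_measure L2_add L2_diff flip: ennreal_plus) (simp add: ennreal_plus ennreal_mult)
qed auto

text \<open>Young's inequality for the mixed term, read off from the nonnegative measure of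
  \<open>t f - g\<close>. The free \<open>t\<close> allows the factor in front of \<open>f\<close>
  to be as close to 1 as desired.\<close>

lemma nn_integral_scalar_measure_add_le:
  assumes f: "f \<in> L2 m" and g: "g \<in> L2 m" and t: "0 < t" and [measurable]: "\<phi> \<in> borel_measurable borel"
  shows "(\<integral>\<^sup>+l. \<phi> l \<partial>M (\<lambda>x. f x + g x))
    \<le> ennreal (1 + t) * (\<integral>\<^sup>+l. \<phi> l \<partial>M f) + ennreal (1 + 1 / t) * (\<integral>\<^sup>+l. \<phi> l \<partial>M g)"
proof -
  have "(\<integral>\<^sup>+l. \<phi> l \<partial>M (\<lambda>x. f x + g x)) + (\<integral>\<^sup>+l. \<phi> l \<partial>null_measure borel)
    \<le> ennreal (1 + t) * (\<integral>\<^sup>+l. \<phi> l \<partial>M f) + ennreal (1 + 1 / t) * (\<integral>\<^sup>+l. \<phi> l \<partial>M g)"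
  proof (rule nn_integral_add_measures_le[where N = borel])
    fix A :: "real set" assume A: "A \<in> sets borel"
    have "0 \<le> measure (M (\<lambda>x. t * f x - g x)) A"
      by simp
    also have "\<dots> = t\<^sup>2 * measure (M f) A + measure (M g) A - 2 * t * l2_inner m (P A f) g"
      using A f g by (simp add: measure_scalar_measure_diff L2_scale proj_scale measure_scalar_measure
          l2_inner_scale_right power2_eq_square)
    finally have "2 * t * l2_inner m (P A f) g \<le> t\<^sup>2 * measure (M f) A + measure (M g) A"
      by simp
    then have "2 * l2_inner m (P A f) g \<le> t * measure (M f) A + 1 / t * measure (M g) A"
      using t by (simp add: field_simps power2_eq_square)
    then have "measure (M (\<lambda>x. f x + g x)) A \<le> (1 + t) * measure (M f) A + (1 + 1 / t) * measure (M g) A"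
      unfolding measure_scalar_measure_add[OF A f g] by (simp add: algebra_simps)
    then have "ennreal (measure (M (\<lambda>x. f x + g x)) A)
        \<le> ennreal (1 + t) * ennreal (measure (M f) A) + ennreal (1 + 1 / t) * ennreal (measure (M g) A)"
      using t by (simp flip: ennreal_plus ennreal_mult)
    then show "emeasure (M (\<lambda>x. f x + g x)) A + emeasure (null_measure borel) A
        \<le> ennreal (1 + t) * emeasure (M f) A + ennreal (1 + 1 / t) * emeasure (M g) A"
      using f g by (simp add: emeasure_eq_measure L2_add)
  qed auto
  then show ?thesis
    by simp
qed

lemma scalar_measure_proj:
  assumes [measurable]: "C \<in> sets borel" and f: "f \<in> L2 m"
  shows "M (P C f) = density (M f) (indicator C)"
proof (rule measure_eqI)
  fix A assume "A \<in> sets (M (P C f))"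
  then have A [measurable]: "A \<in> sets borel"
    by simp
  have "l2_inner m (P A (P C f)) (P C f) = l2_inner m (P (C \<inter> A) f) f"
    using A f by (simp add: inner_proj_proj proj_proj proj_L2 Int_ac)
  then show "emeasure (M (P C f)) A = emeasure (density (M f) (indicator C)) A"
    using f A by (simp add: emeasure_scalar_measure proj_L2 emeasure_density nn_integral_indicator
        flip: indicator_inter_arith)
qed simp

lemma nn_integral_proj:
  assumes [measurable]: "C \<in> sets borel" "\<phi> \<in> borel_measurable borel" and f: "f \<in> L2 m"
  shows "(\<integral>\<^sup>+l. \<phi> l \<partial>M (P C f)) = (\<integral>\<^sup>+l. indicator C l * \<phi> l \<partial>M f)"
  by (simp add: scalar_measure_proj f nn_integral_density)

section \<open>Domains of spectral integrals and cut-off vectors\<close>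

lemma spectral_domain_iff:
  assumes [measurable]: "\<phi> \<in> borel_measurable borel"
  shows "f \<in> spectral_domain m P \<phi> \<longleftrightarrow> f \<in> L2 m \<and> integrable (M f) (\<lambda>l. (\<phi> l)\<^sup>2)"
  by (auto simp: spectral_domain_def integrable_iff_bounded)

lemma spectral_domain_integrable:
  assumes [measurable]: "\<phi> \<in> borel_measurable borel" and f: "f \<in> spectral_domain m P \<phi>"
  shows "integrable (M f) \<phi>"
proof (rule Bochner_Integration.integrable_bound)
  have "f \<in> L2 m"
    using f by (simp add: spectral_domain_def)
  then interpret finite_measure "M f"
    by (rule finite_scalar_measure)
  show "integrable (M f) (\<lambda>l. 1 + (\<phi> l)\<^sup>2)"
    using f by (simp add: spectral_domain_iff)
  have "\<bar>x\<bar> \<le> 1 + x\<^sup>2" for x :: real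
  proof -
    have "0 \<le> (\<bar>x\<bar> - 1)\<^sup>2 + \<bar>x\<bar>"
      by simp
    then show ?thesis
      by (simp add: power2_diff)
  qed
  then show "AE l in M f. norm (\<phi> l) \<le> norm (1 + (\<phi> l)\<^sup>2)"
    by (auto intro!: AE_I2)
qed simp

lemma spectral_domain_add_diff:
  assumes \<phi> [measurable]: "\<phi> \<in> borel_measurable borel"
    and f: "f \<in> spectral_domain m P \<phi>" and g: "g \<in> spectral_domain m P \<phi>"
  shows "(\<lambda>x. f x + g x) \<in> spectral_domain m P \<phi>" "(\<lambda>x. f x - g x) \<in> spectral_domain m P \<phi>"
proof -
  have L2: "f \<in> L2 m" "g \<in> L2 m"
    using f g by (auto simp: spectral_domain_def)
  have "(\<integral>\<^sup>+l. ennreal ((\<phi> l)\<^sup>2) \<partial>M (\<lambda>x. f x + g x)) + (\<integral>\<^sup>+l. ennreal ((\<phi> l)\<^sup>2) \<partial>M (\<lambda>x. f x - g x))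
    \<le> 2 * (\<integral>\<^sup>+l. ennreal ((\<phi> l)\<^sup>2) \<partial>M f) + 2 * (\<integral>\<^sup>+l. ennreal ((\<phi> l)\<^sup>2) \<partial>M g)"
    by (rule nn_integral_parallelogram[OF L2]) measurable
  also have "\<dots> < \<infinity>"
    using f g by (auto simp: spectral_domain_def ennreal_mult_less_top)
  finally show "(\<lambda>x. f x + g x) \<in> spectral_domain m P \<phi>" "(\<lambda>x. f x - g x) \<in> spectral_domain m P \<phi>"
    using L2 by (auto simp: spectral_domain_def L2_add L2_diff)
qed

text \<open>Supplies the cut-off vectors: with \<open>C\<close> a set on which
  \<open>\<bar>\<phi>\<bar> \<le> n\<close>, they lie in the domain and approximate \<open>f\<close>
  as \<open>n\<close> grows.\<close>

lemma proj_in_spectral_domain: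
  assumes [measurable]: "C \<in> sets borel" "\<phi> \<in> borel_measurable borel" and f: "f \<in> L2 m"
    and bound: "\<And>l. l \<in> C \<Longrightarrow> \<bar>\<phi> l\<bar> \<le> K"
  shows "P C f \<in> spectral_domain m P \<phi>"
proof -
  have "(\<integral>\<^sup>+l. ennreal ((\<phi> l)\<^sup>2) \<partial>M (P C f)) = (\<integral>\<^sup>+l. indicator C l * ennreal ((\<phi> l)\<^sup>2) \<partial>M f)"
    by (rule nn_integral_proj) (use f in auto)
  also have "\<dots> \<le> (\<integral>\<^sup>+l. ennreal (K\<^sup>2) \<partial>M f)"
    using bound by (intro nn_integral_mono) (force simp: indicator_def intro!: ennreal_leI abs_le_square_iff[THEN iffD1])
  also have "\<dots> < \<infinity>"
    using f by (simp add: emeasure_eq_measure ennreal_mult_less_top)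
  finally show ?thesis
    using f by (simp add: spectral_domain_def proj_L2)
qed

lemma measure_proj_tendsto:
  assumes C: "incseq C" "\<And>n. C n \<in> sets borel" "(\<Union>n. C n) = UNIV" and f: "f \<in> L2 m"
  shows "(\<lambda>n. l2_inner m (P (C n) f) f) \<longlonglongrightarrow> l2_inner m f f"
proof -
  interpret finite_measure "M f"
    by (rule finite_scalar_measure[OF f])
  have "(\<lambda>n. measure (M f) (C n)) \<longlonglongrightarrow> measure (M f) (\<Union>n. C n)"
    using C by (intro finite_Lim_measure_incseq) auto
  then show ?thesis
    using C f by (simp add: measure_scalar_measure proj_UNIV)
qed

text \<open>Pythagoras: \<open>P C f\<close> and \<open>f - P C f\<close> are orthogonal.\<close>

lemma inner_compl_proj:
  assumes "C \<in> sets borel" "f \<in> L2 m"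
  shows "l2_inner m (\<lambda>x. f x - P C f x) (\<lambda>x. f x - P C f x) = l2_inner m f f - l2_inner m (P C f) f"
  using assms
  by (simp add: l2_inner_diff_left l2_inner_diff_right L2_diff proj_L2 inner_proj_proj
      l2_inner_commute[of m f "P C f"])

lemma proj_l2_tendsto:
  assumes C: "incseq C" "\<And>n. C n \<in> sets borel" "(\<Union>n. C n) = UNIV" and f: "f \<in> L2 m"
  shows "l2_tendsto m (\<lambda>n. P (C n) f) f"
proof -
  have "l2_inner m (\<lambda>x. P (C n) f x - f x) (\<lambda>x. P (C n) f x - f x) = l2_inner m f f - l2_inner m (P (C n) f) f" for n
    unfolding inner_compl_proj[OF C(2) f, symmetric]
    by (simp add: l2_inner_def power2_commute flip: power2_eq_square)
  moreover have "(\<lambda>n. l2_inner m f f - l2_inner m (P (C n) f) f) \<longlonglongrightarrow> l2_inner m f f - l2_inner m f f"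
    by (intro tendsto_intros measure_proj_tendsto assms)
  ultimately show ?thesis
    by (simp add: l2_tendsto_iff_inner)
qed

section \<open>Spectral integrals\<close>

text \<open>The operator \<open>\<integral> s dP\<close> applied to \<open>f\<close>, for
  \<open>s\<close> of finite range.\<close>

definition simple_op :: "(real \<Rightarrow> real) \<Rightarrow> ('a \<Rightarrow> real) \<Rightarrow> 'a \<Rightarrow> real" where
  "simple_op s f x = (\<Sum>c\<in>range s. c * P (s -` {c}) f x)"

lemma simple_function_levels:
  assumes "simple_function borel s"
  shows "finite (range s)" "s -` {c} \<in> sets borel"
  using simple_functionD[OF assms] by simp_all

lemma simple_function_eq_sum_levels:
  fixes s :: "real \<Rightarrow> real"
  assumes "simple_function borel s"
  shows "s l = (\<Sum>c\<in>range s. c * indicator (s -` {c}) l)"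
proof -
  have "(\<Sum>c\<in>range s. c * indicator (s -` {c}) l) = (\<Sum>c\<in>range s. if c = s l then c else 0)"
    by (intro sum.cong) (auto simp: indicator_def)
  then show ?thesis
    using simple_function_levels[OF assms] by simp
qed

lemma simple_op_L2:
  assumes "simple_function borel s" "f \<in> L2 m"
  shows "simple_op s f \<in> L2 m"
  using assms simple_function_levels[OF assms(1)]
  unfolding simple_op_def[abs_def] by (intro L2_sum L2_scale proj_L2) auto

lemma inner_simple_op:
  assumes "simple_function borel s" "f \<in> L2 m" "g \<in> L2 m"
  shows "l2_inner m (simple_op s f) g = (\<Sum>c\<in>range s. c * l2_inner m (P (s -` {c}) f) g)"
  using assms simple_function_levels[OF assms(1)] unfolding simple_op_def[abs_def]
  by (subst l2_inner_sum_left) (auto intro!: L2_scale proj_L2 simp: l2_inner_scale_left)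

lemma integral_simple_function:
  assumes s: "simple_function borel s" and f: "f \<in> L2 m"
  shows "(LINT l|M f. s l) = (\<Sum>c\<in>range s. c * measure (M f) (s -` {c}))"
proof -
  interpret finite_measure "M f"
    by (rule finite_scalar_measure[OF f])
  note [measurable] = simple_function_levels(2)[OF s]
  have "(LINT l|M f. s l) = (LINT l|M f. (\<Sum>c\<in>range s. c * indicator (s -` {c}) l))"
    by (intro Bochner_Integration.integral_cong refl simple_function_eq_sum_levels[OF s])
  also have "\<dots> = (\<Sum>c\<in>range s. c * measure (M f) (s -` {c}))"
    by (subst Bochner_Integration.integral_sum) (auto simp: less_top[symmetric])
  finally show ?thesis .
qed

lemma integral_simple_function_eq_inner:
  assumes "simple_function borel s" "f \<in> L2 m"
  shows "(LINT l|M f. s l) = l2_inner m (simple_op s f) f"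
  using assms by (simp add: integral_simple_function inner_simple_op measure_scalar_measure simple_function_levels)

text \<open>Because \<open>P B\<close> and \<open>P C\<close> multiply to
  \<open>P (B \<inter> C)\<close>, the map \<open>s \<mapsto> simple_op s f\<close> is an isometry
  from simple functions in \<open>L\<^sup>2(M f)\<close> into \<open>L\<^sup>2(m)\<close>; this
  drives the passage to general integrands.\<close>

lemma integral_simple_function_mult:
  assumes s: "simple_function borel s" and t: "simple_function borel t" and f: "f \<in> L2 m"
  shows "(LINT l|M f. s l * t l) = l2_inner m (simple_op s f) (simple_op t f)"
proof -
  interpret finite_measure "M f"
    by (rule finite_scalar_measure[OF f])
  note [measurable] = simple_function_levels(2)[OF s] simple_function_levels(2)[OF t]
  have "(LINT l|M f. s l * t l) =
      (LINT l|M f. (\<Sum>c\<in>range s. \<Sum>d\<in>range t. (c * d) * indicator (s -` {c} \<inter> t -` {d}) l))"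
  proof (intro Bochner_Integration.integral_cong refl)
    fix l
    show "s l * t l = (\<Sum>c\<in>range s. \<Sum>d\<in>range t. (c * d) * indicator (s -` {c} \<inter> t -` {d}) l)"
      by (subst simple_function_eq_sum_levels[OF s], subst simple_function_eq_sum_levels[OF t])
        (simp add: sum_product indicator_inter_arith ac_simps)
  qed
  also have "\<dots> = (\<Sum>c\<in>range s. \<Sum>d\<in>range t. (c * d) * measure (M f) (s -` {c} \<inter> t -` {d}))"
    by (simp add: Bochner_Integration.integral_sum less_top[symmetric])
  also have "\<dots> = (\<Sum>c\<in>range s. \<Sum>d\<in>range t. (c * d) * l2_inner m (P (s -` {c}) f) (P (t -` {d}) f))"
    using f by (simp add: measure_scalar_measure inner_proj_proj)
  also have "\<dots> = (\<Sum>c\<in>range s. c * l2_inner m (simple_op t f) (P (s -` {c}) f))"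
    using f t by (simp add: inner_simple_op proj_L2 sum_distrib_left mult.assoc l2_inner_commute)
  also have "\<dots> = l2_inner m (simple_op s f) (simple_op t f)"
    using f s t by (simp add: inner_simple_op simple_op_L2 l2_inner_commute[of m "simple_op t f"])
  finally show ?thesis .
qed

lemma polar_simple_op:
  assumes s: "simple_function borel s" and f: "f \<in> L2 m" and g: "g \<in> L2 m"
  shows "polar_integral m P s f g = l2_inner m (simple_op s f) g"
proof -
  note lev = simple_function_levels[OF s]
  have "polar_integral m P s f g = ((\<Sum>c\<in>range s. c * measure (M (\<lambda>x. f x + g x)) (s -` {c})) -
      (\<Sum>c\<in>range s. c * measure (M (\<lambda>x. f x - g x)) (s -` {c}))) / 4"
    unfolding polar_integral_def using s f g by (simp add: integral_simple_function L2_add L2_diff)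
  \<comment> \<open>The sum contributes the mixed term twice and the difference removes it twice,
    hence the 4.\<close>
  also have "\<dots> = (\<Sum>c\<in>range s. c * (4 * l2_inner m (P (s -` {c}) f) g)) / 4"
    unfolding sum_subtractf[symmetric] right_diff_distrib[symmetric]
    using lev f g by (simp add: measure_scalar_measure_add measure_scalar_measure_diff)
  also have "\<dots> = l2_inner m (simple_op s f) g"
    using s f g by (simp add: inner_simple_op sum_distrib_left[symmetric] mult.left_commute[of _ 4])
  finally show ?thesis .
qed

text \<open>Here \<open>u\<close> is the limit of \<open>simple_op (s i) f\<close>, which is Cauchy
  by the isometry. The last property says that \<open>u\<close> lies in the closed span of the
  vectors \<open>P B f\<close>. All four are proved for this particular \<open>u\<close>, since the
  approximants are available only here.\<close>

lemma spectral_integral_exists_aux: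
  assumes \<phi> [measurable]: "\<phi> \<in> borel_measurable borel" and f: "f \<in> spectral_domain m P \<phi>"
  obtains u where "(f, u) \<in> spectral_integral m P \<phi>"
    "l2_inner m u u = (LINT l|M f. (\<phi> l)\<^sup>2)" "l2_inner m u f = (LINT l|M f. \<phi> l)"
    "\<And>g. g \<in> L2 m \<Longrightarrow> (\<And>B. B \<in> sets borel \<Longrightarrow> l2_inner m (P B f) g = 0) \<Longrightarrow> l2_inner m u g = 0"
proof -
  \<comment> \<open>The approximation is relative to the base point 0, which yields the domination
    by \<open>2 * \<bar>\<phi> l\<bar>\<close>; the constants 4 and 9 below are its consequences,
    the latter through
    \<open>\<bar>s i l - \<phi> l\<bar> \<le> 3 * \<bar>\<phi> l\<bar>\<close>.\<close>
  obtain s where s: "\<And>i. simple_function borel (s i)" and lim: "\<And>l. (\<lambda>i. s i l) \<longlonglongrightarrow> \<phi> l"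
    and bd: "\<And>i l. \<bar>s i l\<bar> \<le> 2 * \<bar>\<phi> l\<bar>"
    using borel_measurable_implies_sequence_metric[OF \<phi>, of 0] by (auto simp: dist_real_def)
  have [measurable]: "s i \<in> borel_measurable borel" for i
    using s by (rule borel_measurable_simple_function)
  have fL2: "f \<in> L2 m" and int: "integrable (M f) (\<lambda>l. (\<phi> l)\<^sup>2)"
    using f by (auto simp: spectral_domain_iff)
  have lim_int: "(\<lambda>i. LINT l|M h. s i l) \<longlonglongrightarrow> (LINT l|M h. \<phi> l)" if "h \<in> spectral_domain m P \<phi>" for h
  proof (rule integral_dominated_convergence[where w = "\<lambda>l. 2 * \<bar>\<phi> l\<bar>"])
    show "integrable (M h) (\<lambda>l. 2 * \<bar>\<phi> l\<bar>)"
      using spectral_domain_integrable[OF \<phi> that] by simp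
  qed (use lim bd in auto)
  have sq_bd: "\<bar>s i l * s j l\<bar> \<le> 4 * (\<phi> l)\<^sup>2" for i j l
  proof -
    have "\<bar>s i l * s j l\<bar> \<le> (2 * \<bar>\<phi> l\<bar>) * (2 * \<bar>\<phi> l\<bar>)"
      unfolding abs_mult by (intro mult_mono bd) auto
    then show ?thesis
      by (simp add: power2_eq_square)
  qed
  have lim_sq: "(\<lambda>i. LINT l|M f. s i l * s i l) \<longlonglongrightarrow> (LINT l|M f. (\<phi> l)\<^sup>2)"
  proof (rule integral_dominated_convergence[where w = "\<lambda>l. 4 * (\<phi> l)\<^sup>2"])
    show "AE l in M f. (\<lambda>i. s i l * s i l) \<longlonglongrightarrow> (\<phi> l)\<^sup>2"
      unfolding power2_eq_square by (intro AE_I2 tendsto_mult lim)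
    show "AE l in M f. norm (s i l * s i l) \<le> 4 * (\<phi> l)\<^sup>2" for i
      unfolding real_norm_def by (intro AE_I2 sq_bd)
  qed (use int in auto)
  have int_ss: "integrable (M f) (\<lambda>l. s i l * s j l)" for i j
    by (rule Bochner_Integration.integrable_bound[where f = "\<lambda>l. 4 * (\<phi> l)\<^sup>2"])
      (use int sq_bd in auto)
  have d_bd: "(s i l - \<phi> l)\<^sup>2 \<le> 9 * (\<phi> l)\<^sup>2" for i l
  proof -
    have "\<bar>s i l - \<phi> l\<bar> \<le> \<bar>3 * \<phi> l\<bar>"
      using bd[of i l] by linarith
    then show ?thesis
      unfolding abs_le_square_iff by (simp add: power_mult_distrib)
  qed
  have int_d: "integrable (M f) (\<lambda>l. (s i l - \<phi> l)\<^sup>2)" for i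
    by (rule Bochner_Integration.integrable_bound[where f = "\<lambda>l. 9 * (\<phi> l)\<^sup>2"])
      (use int d_bd in auto)
  define d where "d i = (LINT l|M f. (s i l - \<phi> l)\<^sup>2)" for i
  have "(\<lambda>i. LINT l|M f. (s i l - \<phi> l)\<^sup>2) \<longlonglongrightarrow> (LINT l|M f. 0)"
  proof (rule integral_dominated_convergence[where w = "\<lambda>l. 9 * (\<phi> l)\<^sup>2"])
    show "AE l in M f. (\<lambda>i. (s i l - \<phi> l)\<^sup>2) \<longlonglongrightarrow> 0"
      using lim by (auto intro!: AE_I2 tendsto_eq_intros)
  qed (use int d_bd in auto)
  then have d0: "d \<longlonglongrightarrow> 0"
    by (simp add: d_def[abs_def])
  let ?S = "\<lambda>i. simple_op (s i) f"
  have S_L2: "?S i \<in> L2 m" for i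
    by (rule simple_op_L2[OF s fL2])
  \<comment> \<open>The isometry turns the distance into the integral of
    \<open>(s i l - s j l)\<^sup>2\<close>, and
    \<open>(x - y)\<^sup>2 \<le> 2 * x\<^sup>2 + 2 * y\<^sup>2\<close> is used with
    \<open>x\<close>, \<open>y\<close> the deviations from \<open>\<phi> l\<close>.\<close>
  have dist: "l2_inner m (\<lambda>x. ?S i x - ?S j x) (\<lambda>x. ?S i x - ?S j x) \<le> 2 * d i + 2 * d j" for i j
  proof -
    have "l2_inner m (\<lambda>x. ?S i x - ?S j x) (\<lambda>x. ?S i x - ?S j x)
        = (LINT l|M f. s i l * s i l) - (LINT l|M f. s i l * s j l) - (LINT l|M f. s j l * s i l)
          + (LINT l|M f. s j l * s j l)"
      by (simp add: integral_simple_function_mult s fL2 l2_inner_diff_left l2_inner_diff_right S_L2 L2_diff)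
    also have "\<dots> = (LINT l|M f. s i l * s i l - s i l * s j l - s j l * s i l + s j l * s j l)"
      by (simp add: int_ss) (simp add: mult.commute)
    also have "\<dots> \<le> (LINT l|M f. 2 * (s i l - \<phi> l)\<^sup>2 + 2 * (s j l - \<phi> l)\<^sup>2)"
    proof (rule integral_mono)
      fix l
      have "0 \<le> ((s i l - \<phi> l) + (s j l - \<phi> l))\<^sup>2"
        by simp
      then show "s i l * s i l - s i l * s j l - s j l * s i l + s j l * s j l
          \<le> 2 * (s i l - \<phi> l)\<^sup>2 + 2 * (s j l - \<phi> l)\<^sup>2"
        by (simp add: power2_eq_square algebra_simps)
    qed (use int_ss int_d in simp_all)
    also have "\<dots> = 2 * d i + 2 * d j"
      by (simp add: d_def int_d)
    finally show ?thesis .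
  qed
  obtain u where u: "u \<in> L2 m" and Su: "l2_tendsto m ?S u"
  proof (rule L2_complete[of ?S, OF S_L2])
    fix e :: real assume "0 < e"
    then obtain N where N: "\<And>n. N \<le> n \<Longrightarrow> \<bar>d n\<bar> < e / 4"
      using LIMSEQ_D[OF d0, of "e / 4"] by auto
    have "l2_inner m (\<lambda>x. ?S i x - ?S j x) (\<lambda>x. ?S i x - ?S j x) < e" if "N \<le> i" "N \<le> j" for i j
      using dist[of i j] N[OF that(1)] N[OF that(2)] by linarith
    then show "\<exists>N. \<forall>i\<ge>N. \<forall>j\<ge>N. l2_inner m (\<lambda>x. ?S i x - ?S j x) (\<lambda>x. ?S i x - ?S j x) < e"
      by blast
  qed
  have S_inner: "(\<lambda>i. l2_inner m (?S i) g) \<longlonglongrightarrow> l2_inner m u g" if "g \<in> L2 m" for g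
    by (rule l2_tendsto_inner_left[OF Su S_L2 u that])
  have "l2_inner m u g = polar_integral m P \<phi> f g" if g: "g \<in> spectral_domain m P \<phi>" for g
  proof -
    have gL2: "g \<in> L2 m"
      using g by (simp add: spectral_domain_def)
    have "(\<lambda>i. polar_integral m P (s i) f g) \<longlonglongrightarrow> polar_integral m P \<phi> f g"
      unfolding polar_integral_def
      by (intro tendsto_intros lim_int spectral_domain_add_diff[OF \<phi> f g]) simp
    then have "(\<lambda>i. l2_inner m (?S i) g) \<longlonglongrightarrow> polar_integral m P \<phi> f g"
      by (simp add: polar_simple_op s fL2 gL2)
    then show ?thesis
      by (rule LIMSEQ_unique[OF S_inner[OF gL2]])
  qed
  then have "(f, u) \<in> spectral_integral m P \<phi>"
    using f u by (simp add: spectral_integral_def)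
  moreover have "l2_inner m u u = (LINT l|M f. (\<phi> l)\<^sup>2)"
    using l2_tendsto_inner_self[OF Su S_L2 u] lim_sq
    by (intro LIMSEQ_unique) (simp_all add: integral_simple_function_mult s fL2)
  moreover have "l2_inner m u f = (LINT l|M f. \<phi> l)"
    using S_inner[OF fL2] lim_int[OF f]
    by (intro LIMSEQ_unique) (simp_all add: integral_simple_function_eq_inner s fL2)
  moreover have "l2_inner m u g = 0"
    if g: "g \<in> L2 m" and zero: "\<And>B. B \<in> sets borel \<Longrightarrow> l2_inner m (P B f) g = 0" for g
  proof -
    have "l2_inner m (?S i) g = 0" for i
      using zero simple_function_levels(2)[OF s] by (simp add: inner_simple_op s fL2 g)
    then show ?thesis
      using S_inner[OF g] by (simp add: LIMSEQ_const_iff)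
  qed
  ultimately show thesis
    by (rule that)
qed

lemma level_sets_exhaust:
  assumes [measurable]: "(\<phi> :: real \<Rightarrow> real) \<in> borel_measurable borel"
  shows "incseq (\<lambda>n::nat. {l. \<bar>\<phi> l\<bar> \<le> n})" "{l. \<bar>\<phi> l\<bar> \<le> real n} \<in> sets borel"
    "(\<Union>n::nat. {l. \<bar>\<phi> l\<bar> \<le> n}) = UNIV"
proof -
  show "{l. \<bar>\<phi> l\<bar> \<le> real n} \<in> sets borel"
    by measurable
qed (auto simp: incseq_def intro: real_arch_simple)

text \<open>Values are tested only against the domain, so the difference \<open>w\<close> of two
  values is tested against its own cut-offs \<open>P (C n) w\<close>. This gives
  \<open>\<langle>P (C n) w, w\<rangle> = 0\<close>, which tends to the squared norm of
  \<open>w\<close>.\<close>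

lemma spectral_integral_unique:
  assumes \<phi> [measurable]: "\<phi> \<in> borel_measurable borel"
    and u: "(f, u) \<in> spectral_integral m P \<phi>" and v: "(f, v) \<in> spectral_integral m P \<phi>"
  shows "AE x in m. u x = v x"
proof -
  let ?w = "\<lambda>x. u x - v x" and ?C = "\<lambda>n::nat. {l. \<bar>\<phi> l\<bar> \<le> n}"
  note C = level_sets_exhaust[OF \<phi>]
  have L2: "u \<in> L2 m" "v \<in> L2 m"
    using u v by (auto simp: spectral_integral_def)
  then have w: "?w \<in> L2 m"
    by (rule L2_diff)
  have "l2_inner m (P (?C n) ?w) ?w = 0" for n
  proof -
    have "P (?C n) ?w \<in> spectral_domain m P \<phi>"
      using w by (intro proj_in_spectral_domain[where K = n]) auto
    then have "l2_inner m u (P (?C n) ?w) = l2_inner m v (P (?C n) ?w)"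
      using u v by (simp add: spectral_integral_def)
    then show ?thesis
      using L2 w C(2) by (simp add: l2_inner_commute[of m _ ?w] l2_inner_diff_left proj_L2)
  qed
  then have "l2_inner m ?w ?w = 0"
    using measure_proj_tendsto[OF C w] by (simp add: LIMSEQ_const_iff)
  then show ?thesis
    using l2_inner_self_eq_0[OF w] by simp
qed

lemma spectral_integral_exists:
  assumes "\<phi> \<in> borel_measurable borel" "f \<in> spectral_domain m P \<phi>"
  obtains u where "(f, u) \<in> spectral_integral m P \<phi>"
  using spectral_integral_exists_aux[OF assms] by blast

text \<open>Uniqueness carries the properties of the constructed value over to every representative
  in the graph.\<close>

lemma
  assumes \<phi>: "\<phi> \<in> borel_measurable borel" and u: "(f, u) \<in> spectral_integral m P \<phi>"
  shows spectral_integral_norm: "l2_inner m u u = (LINT l|M f. (\<phi> l)\<^sup>2)"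
    and spectral_integral_inner: "l2_inner m u f = (LINT l|M f. \<phi> l)"
    and spectral_integral_orthogonal: "\<And>g. g \<in> L2 m \<Longrightarrow>
      (\<And>B. B \<in> sets borel \<Longrightarrow> l2_inner m (P B f) g = 0) \<Longrightarrow> l2_inner m u g = 0"
proof -
  have f: "f \<in> spectral_domain m P \<phi>" and fL2: "f \<in> L2 m" and uL2: "u \<in> L2 m"
    using u by (auto simp: spectral_integral_def spectral_domain_def)
  obtain v where v: "(f, v) \<in> spectral_integral m P \<phi>"
    and norm: "l2_inner m v v = (LINT l|M f. (\<phi> l)\<^sup>2)" and inner: "l2_inner m v f = (LINT l|M f. \<phi> l)"
    and orth: "\<And>g. g \<in> L2 m \<Longrightarrow> (\<And>B. B \<in> sets borel \<Longrightarrow> l2_inner m (P B f) g = 0) \<Longrightarrow> l2_inner m v g = 0"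
    using spectral_integral_exists_aux[OF \<phi> f] by blast
  have vL2: "v \<in> L2 m"
    using v by (simp add: spectral_integral_def)
  have eq: "l2_inner m u g = l2_inner m v g" if "g \<in> L2 m" for g
    using spectral_integral_unique[OF \<phi> u v] uL2 vL2 that by (rule l2_inner_cong_AE)
  show "l2_inner m u u = (LINT l|M f. (\<phi> l)\<^sup>2)"
    using eq[OF uL2] eq[OF vL2] norm by (simp add: l2_inner_commute[of m v u])
  show "l2_inner m u f = (LINT l|M f. \<phi> l)"
    using eq[OF fL2] inner by simp
  show "l2_inner m u g = 0" if "g \<in> L2 m" "\<And>B. B \<in> sets borel \<Longrightarrow> l2_inner m (P B f) g = 0" for g
    using eq[OF that(1)] orth[OF that] by simp
qed

end

section \<open>Comparison of spectral integrals\<close>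

context projection_measure
begin

text \<open>Mass on the negative half-line would yield, by projecting \<open>f\<close> there, a
  vector \<open>h\<close> with \<open>\<langle>A h, h\<rangle> < 0\<close>.\<close>

lemma AE_scalar_measure_nonneg:
  assumes pos: "\<And>h k. (h, k) \<in> spectral_integral m P (\<lambda>l. l) \<Longrightarrow> 0 \<le> l2_inner m k h" and f: "f \<in> L2 m"
  shows "AE l in M f. 0 \<le> l"
proof -
  interpret finite_measure "M f"
    by (rule finite_scalar_measure[OF f])
  have "AE l in M f. \<not> (- real n \<le> l \<and> l < 0)" for n
  proof -
    \<comment> \<open>The lower end puts the projected vector into the domain; leaving out 0 makes
      the integrand nonzero on all of \<open>?C\<close>.\<close>
    let ?C = "{- real n..<0}"
    have "P ?C f \<in> spectral_domain m P (\<lambda>l. l)"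
      using f by (intro proj_in_spectral_domain[where K = n]) auto
    then obtain k where k: "(P ?C f, k) \<in> spectral_integral m P (\<lambda>l. l)"
      using spectral_integral_exists[of "\<lambda>l. l"] by auto
    have "0 \<le> (LINT l|M (P ?C f). l)"
      using pos[OF k] spectral_integral_inner[OF _ k] by simp
    also have "\<dots> = (LINT l|M f. indicator ?C l * l)"
    proof -
      have "(LINT l|density (M f) (\<lambda>l. ennreal (indicator ?C l)). l) = (LINT l|M f. indicator ?C l *\<^sub>R l)"
        by (rule integral_density) auto
      then show ?thesis
        using f by (simp add: scalar_measure_proj ennreal_indicator)
    qed
    finally have ge: "0 \<le> (LINT l|M f. indicator ?C l * l)" .
    have int: "integrable (M f) (\<lambda>l. - (indicator ?C l * l))"
      by (rule integrable_const_bound[where B = n]) (auto simp: indicator_def)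
    have nn: "0 \<le> - (indicator ?C l * l)" for l :: real
      by (auto simp: indicator_def)
    have "(LINT l|M f. - (indicator ?C l * l)) = 0"
    proof (rule antisym)
      show "(LINT l|M f. - (indicator ?C l * l)) \<le> 0"
        using ge by simp
      show "0 \<le> (LINT l|M f. - (indicator ?C l * l))"
        using nn by (intro integral_nonneg_AE AE_I2)
    qed
    then have "AE l in M f. - (indicator ?C l * l) = 0"
      using integral_nonneg_eq_0_iff_AE[OF int] nn by simp
    then show ?thesis
      by eventually_elim (auto simp: indicator_def split: if_splits)
  qed
  then have "AE l in M f. \<forall>n::nat. \<not> (- real n \<le> l \<and> l < 0)"
    unfolding AE_all_countable by blast
  then show ?thesis
  proof eventually_elim
    case (elim l)
    obtain n :: nat where "- l \<le> n"
      using real_arch_simple by blast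
    then show ?case
      using elim by (metis minus_le_iff not_le)
  qed
qed

text \<open>For \<open>A = \<integral> l dP \<ge> 0\<close> with form \<open>q\<close> this is \<open>2 \<langle>A h, f\<rangle> - q(h) = q(f) - q(h - f) \<le> q(f)\<close>,
  with equality for \<open>h = f\<close>.\<close>

lemma spectral_integral_variational:
  assumes hk: "(h, k) \<in> spectral_integral m P (\<lambda>l. l)" and f: "f \<in> L2 m"
    and nonneg: "\<And>f. f \<in> L2 m \<Longrightarrow> AE l in M f. 0 \<le> l"
  shows "ennreal (2 * l2_inner m k f - l2_inner m k h) \<le> (\<integral>\<^sup>+l. ennreal l \<partial>M f)"
proof -
  have id: "(\<lambda>l::real. l) \<in> borel_measurable borel"
    by simp
  have h: "h \<in> spectral_domain m P (\<lambda>l. l)" and k: "k \<in> L2 m"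
    using hk by (auto simp: spectral_integral_def)
  have dom_L2: "g \<in> L2 m" if "g \<in> spectral_domain m P (\<lambda>l. l)" for g
    using that by (simp add: spectral_domain_def)
  define I where "I g = (LINT l|M g. l)" for g
  have I_nonneg: "0 \<le> I g" if "g \<in> L2 m" for g
    unfolding I_def using nonneg[OF that] by (rule integral_nonneg_AE)
  have I: "(\<integral>\<^sup>+l. ennreal l \<partial>M g) = ennreal (I g)" if "g \<in> spectral_domain m P (\<lambda>l. l)" for g
    unfolding I_def using spectral_domain_integrable[OF id that] nonneg[OF dom_L2[OF that]]
    by (rule nn_integral_eq_integral)
  \<comment> \<open>By polarization \<open>4 \<langle>k, g\<rangle> = I (h + g) - I (h - g)\<close>.
    The parallelogram law bounds this by \<open>2 I h + 2 I g - 2 I (h - g)\<close>, and the last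
    term is dropped.\<close>
  have bound: "2 * l2_inner m k g - l2_inner m k h \<le> I g" if g: "g \<in> spectral_domain m P (\<lambda>l. l)" for g
  proof -
    note ad = spectral_domain_add_diff[OF id h g]
    have "ennreal (I (\<lambda>x. h x + g x)) + ennreal (I (\<lambda>x. h x - g x)) \<le> 2 * ennreal (I h) + 2 * ennreal (I g)"
      unfolding I[OF ad(1), symmetric] I[OF ad(2), symmetric] I[OF h, symmetric] I[OF g, symmetric]
      by (rule nn_integral_parallelogram[OF dom_L2[OF h] dom_L2[OF g]]) measurable
    also have "2 * ennreal (I h) + 2 * ennreal (I g) = ennreal (2 * I h + 2 * I g)"
      using dom_L2[OF h] dom_L2[OF g] by (simp add: I_nonneg ennreal_plus ennreal_mult)
    finally have "I (\<lambda>x. h x + g x) + I (\<lambda>x. h x - g x) \<le> 2 * I h + 2 * I g"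
      using ad h g by (simp add: I_nonneg dom_L2 ennreal_le_iff flip: ennreal_plus)
    moreover have "l2_inner m k g = (I (\<lambda>x. h x + g x) - I (\<lambda>x. h x - g x)) / 4"
      using hk g by (simp add: spectral_integral_def polar_integral_def I_def)
    moreover have "l2_inner m k h = I h"
      unfolding I_def by (rule spectral_integral_inner[OF id hk])
    ultimately show ?thesis
      using I_nonneg[OF dom_L2[OF ad(2)]] by simp
  qed
  \<comment> \<open>A general \<open>f\<close> lies outside the domain, so the bound is taken at its
    cut-offs. The left side converges since it is continuous in \<open>f\<close>; the right side
    only grows when the cut-off is removed.\<close>
  let ?C = "\<lambda>n::nat. {l::real. \<bar>l\<bar> \<le> n}"
  note C = level_sets_exhaust[OF id]
  have C_dom: "P (?C n) f \<in> spectral_domain m P (\<lambda>l. l)" for n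
    using f by (intro proj_in_spectral_domain[where K = n]) auto
  have le: "ennreal (2 * l2_inner m k (P (?C n) f) - l2_inner m k h) \<le> (\<integral>\<^sup>+l. ennreal l \<partial>M f)" for n
  proof -
    have "ennreal (2 * l2_inner m k (P (?C n) f) - l2_inner m k h) \<le> (\<integral>\<^sup>+l. ennreal l \<partial>M (P (?C n) f))"
      unfolding I[OF C_dom] by (intro ennreal_leI bound C_dom)
    also have "\<dots> = (\<integral>\<^sup>+l. indicator (?C n) l * ennreal l \<partial>M f)"
      by (rule nn_integral_proj[OF C(2) _ f]) simp
    also have "\<dots> \<le> (\<integral>\<^sup>+l. ennreal l \<partial>M f)"
      by (intro nn_integral_mono) (auto simp: indicator_def)
    finally show ?thesis .
  qed
  have "(\<lambda>n. l2_inner m (P (?C n) f) k) \<longlonglongrightarrow> l2_inner m f k"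
    using C f k by (intro l2_tendsto_inner_left proj_l2_tendsto proj_L2)
  then have "(\<lambda>n. ennreal (2 * l2_inner m k (P (?C n) f) - l2_inner m k h))
      \<longlonglongrightarrow> ennreal (2 * l2_inner m k f - l2_inner m k h)"
    unfolding l2_inner_commute[of m _ k] by (intro tendsto_intros)
  then show ?thesis
    by (rule LIMSEQ_le_const2) (use le in blast)
qed

end

text \<open>For \<open>h = P (C n) f\<close> and \<open>k\<close> its image under
  \<open>\<integral> \<psi> dP\<close>, the inclusion places \<open>(h, k)\<close> in the graph
  resolved by \<open>Q\<close>, where \<open>h\<close> serves as trial vector in the variational
  inequality. As \<open>\<langle>k, f\<rangle> = \<langle>k, h\<rangle>\<close>, the lower bound
  becomes the integral of \<open>\<psi>\<close> over \<open>C n\<close>, and \<open>n\<close> tends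
  to infinity.\<close>

lemma nn_integral_spectral_le:
  assumes "projection_measure m P" "projection_measure m Q"
    and \<psi> [measurable]: "\<psi> \<in> borel_measurable borel"
    and sub: "spectral_integral m P \<psi> \<subseteq> spectral_integral m Q (\<lambda>l. l)"
    and \<psi>_nonneg: "\<And>f. f \<in> L2 m \<Longrightarrow> AE l in scalar_measure m P f. 0 \<le> \<psi> l"
    and Q_nonneg: "\<And>f. f \<in> L2 m \<Longrightarrow> AE l in scalar_measure m Q f. 0 \<le> l"
    and f: "f \<in> L2 m"
  shows "(\<integral>\<^sup>+l. ennreal (\<psi> l) \<partial>scalar_measure m P f) \<le> (\<integral>\<^sup>+l. ennreal l \<partial>scalar_measure m Q f)"
proof -
  interpret P: projection_measure m P by fact
  interpret Q: projection_measure m Q by fact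
  let ?C = "\<lambda>n::nat. {l. \<bar>\<psi> l\<bar> \<le> n}"
  note C = P.level_sets_exhaust[OF \<psi>]
  have le: "(\<integral>\<^sup>+l. indicator (?C n) l * ennreal (\<psi> l) \<partial>P.M f) \<le> (\<integral>\<^sup>+l. ennreal l \<partial>Q.M f)" for n
  proof -
    let ?h = "P (?C n) f"
    have h: "?h \<in> spectral_domain m P \<psi>"
      using f by (intro P.proj_in_spectral_domain[where K = n]) auto
    then obtain k where k: "(?h, k) \<in> spectral_integral m P \<psi>"
      by (rule P.spectral_integral_exists[OF \<psi>])
    have L2: "?h \<in> L2 m" "k \<in> L2 m"
      using k by (auto simp: spectral_integral_def spectral_domain_def)
    \<comment> \<open>The value \<open>k\<close> is in the closed span of the vectors
      \<open>P B ?h\<close>, all in the range of \<open>P (?C n)\<close>, while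
      \<open>f - ?h\<close> is orthogonal to that range.\<close>
    have "l2_inner m k (\<lambda>x. f x - ?h x) = 0"
    proof (rule P.spectral_integral_orthogonal[OF \<psi> k])
      show "(\<lambda>x. f x - ?h x) \<in> L2 m"
        by (intro L2_diff f L2)
      show "l2_inner m (P B ?h) (\<lambda>x. f x - ?h x) = 0" if "B \<in> sets borel" for B
        using that C(2)[of n] f L2
        by (simp add: l2_inner_diff_right P.proj_L2 P.inner_proj_proj P.proj_proj Int_assoc)
    qed
    then have kf: "l2_inner m k f = l2_inner m k ?h"
      using f L2 by (simp add: l2_inner_diff_right)
    have "(\<integral>\<^sup>+l. indicator (?C n) l * ennreal (\<psi> l) \<partial>P.M f) = (\<integral>\<^sup>+l. ennreal (\<psi> l) \<partial>P.M ?h)"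
      by (rule P.nn_integral_proj[symmetric, OF C(2) _ f]) simp
    also have "\<dots> = ennreal (LINT l|P.M ?h. \<psi> l)"
      using P.spectral_domain_integrable[OF \<psi> h] \<psi>_nonneg[OF L2(1)] by (rule nn_integral_eq_integral)
    also have "(LINT l|P.M ?h. \<psi> l) = 2 * l2_inner m k f - l2_inner m k ?h"
      using P.spectral_integral_inner[OF \<psi> k] kf by simp
    also have "ennreal \<dots> \<le> (\<integral>\<^sup>+l. ennreal l \<partial>Q.M f)"
      using k sub by (intro Q.spectral_integral_variational f Q_nonneg) auto
    finally show ?thesis .
  qed
  \<comment> \<open>\<open>ennreal\<close> sends negative values of \<open>\<psi>\<close> to 0, so
    the sequence increases at every point.\<close>
  have inc: "incseq (\<lambda>n l. indicator (?C n) l * ennreal (\<psi> l))"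
    by (auto simp: incseq_def le_fun_def indicator_def)
  have "(\<integral>\<^sup>+l. ennreal (\<psi> l) \<partial>P.M f) = (\<integral>\<^sup>+l. (SUP n. indicator (?C n) l * ennreal (\<psi> l)) \<partial>P.M f)"
  proof (intro nn_integral_cong antisym)
    fix l
    obtain n :: nat where "\<bar>\<psi> l\<bar> \<le> n"
      using real_arch_simple by blast
    then show "ennreal (\<psi> l) \<le> (SUP n. indicator (?C n) l * ennreal (\<psi> l))"
      by (intro SUP_upper2[of n]) auto
    show "(SUP n. indicator (?C n) l * ennreal (\<psi> l)) \<le> ennreal (\<psi> l)"
      by (intro SUP_least) (auto simp: indicator_def)
  qed
  also have "\<dots> = (SUP n. \<integral>\<^sup>+l. indicator (?C n) l * ennreal (\<psi> l) \<partial>P.M f)"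
    by (rule nn_integral_monotone_convergence_SUP[OF inc]) measurable
  also have "\<dots> \<le> (\<integral>\<^sup>+l. ennreal l \<partial>Q.M f)"
    by (intro SUP_least le)
  finally show ?thesis .
qed

section \<open>The form of a nonnegative operator\<close>

locale nonneg_resolution = projection_measure m P for m :: "'a measure" and P +
  fixes L :: "'a l2_op"
  assumes resolution: "spectral_resolution m (op_neg L) P"
    and nonneg: "(h, k) \<in> op_neg L \<Longrightarrow> 0 \<le> l2_inner m k h"

lemma nonneg_resolutionI:
  assumes "spectral_resolution m (op_neg L) P" "\<And>h k. (h, k) \<in> op_neg L \<Longrightarrow> 0 \<le> l2_inner m k h"
  shows "nonneg_resolution m P L"
  using assms by unfold_locales (auto simp: spectral_resolution_def)

context nonneg_resolution
begin

lemma op_eq: "op_neg L = spectral_integral m P (\<lambda>l. l)"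
  using resolution by (simp add: spectral_resolution_def)

lemma AE_nonneg: "f \<in> L2 m \<Longrightarrow> AE l in M f. 0 \<le> l"
  using nonneg by (intro AE_scalar_measure_nonneg) (auto simp: op_eq)

text \<open>The quadratic form extended by \<open>\<infinity>\<close> outside its domain, so that
  inequalities can be stated before membership in the domain is known.\<close>

definition energy :: "('a \<Rightarrow> real) \<Rightarrow> ennreal" where
  "energy f = (\<integral>\<^sup>+l. ennreal l \<partial>M f)"

text \<open>At negative \<open>l\<close> the integrands differ: \<open>(sqrt l)\<^sup>2\<close> is
  \<open>- l\<close>, while \<open>ennreal l\<close> is 0. Such \<open>l\<close> carry no
  mass.\<close>

lemma nn_integral_sqrt_power2: "f \<in> L2 m \<Longrightarrow> (\<integral>\<^sup>+l. ennreal ((sqrt l)\<^sup>2) \<partial>M f) = energy f"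
  unfolding energy_def by (intro nn_integral_cong_AE) (use AE_nonneg in \<open>force intro: AE_mp\<close>)

lemma spectral_domain_sqrt_iff: "f \<in> spectral_domain m P sqrt \<longleftrightarrow> f \<in> L2 m \<and> energy f < \<infinity>"
  using nn_integral_sqrt_power2 by (auto simp: spectral_domain_def)

lemma spectral_integral_sqrt_norm:
  assumes "(f, u) \<in> spectral_integral m P sqrt"
  shows "f \<in> L2 m" "energy f = ennreal (l2_inner m u u)"
proof -
  have sq: "sqrt \<in> borel_measurable borel"
    by simp
  have f: "f \<in> spectral_domain m P sqrt"
    using assms by (simp add: spectral_integral_def)
  then show fL2: "f \<in> L2 m"
    by (simp add: spectral_domain_def)
  have "energy f = ennreal (LINT l|M f. (sqrt l)\<^sup>2)"
    unfolding nn_integral_sqrt_power2[OF fL2, symmetric]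
    using f by (intro nn_integral_eq_integral) (auto simp: spectral_domain_iff[OF sq])
  then show "energy f = ennreal (l2_inner m u u)"
    using spectral_integral_norm[OF sq assms] by simp
qed

end

text \<open>The energy is determined by the operator alone, so uniqueness of spectral resolutions is
  not needed to evaluate \<open>form_of\<close>.\<close>

lemma energy_eq:
  assumes "nonneg_resolution m P L" "nonneg_resolution m Q L" "f \<in> L2 m"
  shows "nonneg_resolution.energy m P f = nonneg_resolution.energy m Q f"
proof -
  interpret P: nonneg_resolution m P L by fact
  interpret Q: nonneg_resolution m Q L by fact
  show ?thesis
    unfolding P.energy_def Q.energy_def
    by (intro antisym nn_integral_spectral_le P.projection_measure_axioms Q.projection_measure_axioms
        P.AE_nonneg Q.AE_nonneg assms(3)) (simp_all add: P.op_eq[symmetric] Q.op_eq[symmetric])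
qed

context nonneg_resolution
begin

text \<open>\<open>fun_calc\<close> is a union over resolutions, so the pair may stem from some
  \<open>Q\<close> other than \<open>P\<close>; the energy is the same for both.\<close>

lemma op_sqrtE:
  assumes "(f, u) \<in> op_sqrt m (op_neg L)"
  shows "f \<in> L2 m" "energy f = ennreal (l2_inner m u u)"
proof -
  obtain Q where Q: "spectral_resolution m (op_neg L) Q" and fu: "(f, u) \<in> spectral_integral m Q sqrt"
    using assms by (auto simp: fun_calc_def)
  interpret Q: nonneg_resolution m Q L
    by (rule nonneg_resolutionI[OF Q nonneg])
  show fL2: "f \<in> L2 m"
    by (rule Q.spectral_integral_sqrt_norm[OF fu])
  show "energy f = ennreal (l2_inner m u u)"
    using Q.spectral_integral_sqrt_norm[OF fu]
      energy_eq[OF nonneg_resolution_axioms Q.nonneg_resolution_axioms fL2] by simp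
qed

lemma form_dom_of_iff: "f \<in> form_dom_of m L \<longleftrightarrow> f \<in> L2 m \<and> energy f < \<infinity>"
proof
  assume "f \<in> form_dom_of m L"
  then show "f \<in> L2 m \<and> energy f < \<infinity>"
    using op_sqrtE by (auto simp: form_dom_of_def)
next
  assume "f \<in> L2 m \<and> energy f < \<infinity>"
  then have "f \<in> spectral_domain m P sqrt"
    by (simp add: spectral_domain_sqrt_iff)
  then obtain u where "(f, u) \<in> spectral_integral m P sqrt"
    using spectral_integral_exists[of sqrt] by auto
  then show "f \<in> form_dom_of m L"
    using resolution by (auto simp: form_dom_of_def fun_calc_def)
qed

lemma form_of_self:
  assumes "f \<in> form_dom_of m L"
  shows "energy f = ennreal (form_of m L f f)" "0 \<le> form_of m L f f"
proof -
  obtain u where "(f, u) \<in> op_sqrt m (op_neg L)"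
    using assms by (auto simp: form_dom_of_def)
  \<comment> \<open>On the diagonal both choices in \<open>form_of\<close> are the same function, so
    the value is a squared norm.\<close>
  then have "(f, SOME u. (f, u) \<in> op_sqrt m (op_neg L)) \<in> op_sqrt m (op_neg L)"
    by (rule someI[where P = "\<lambda>u. (f, u) \<in> op_sqrt m (op_neg L)"])
  then show "energy f = ennreal (form_of m L f f)" "0 \<le> form_of m L f f"
    using op_sqrtE by (auto simp: form_of_def l2_inner_nonneg)
qed

text \<open>Takes the place of the triangle inequality for the square root of the form, and needs
  diagonal values only.\<close>

lemma form_add_le:
  assumes f: "f \<in> form_dom_of m L" and g: "g \<in> form_dom_of m L" and t: "0 < t"
  shows "(\<lambda>x. f x + g x) \<in> form_dom_of m L"
    "form_of m L (\<lambda>x. f x + g x) (\<lambda>x. f x + g x) \<le> (1 + t) * form_of m L f f + (1 + 1 / t) * form_of m L g g"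
proof -
  have L2: "f \<in> L2 m" "g \<in> L2 m"
    using f g by (auto simp: form_dom_of_iff)
  have le: "energy (\<lambda>x. f x + g x) \<le> ennreal (1 + s) * energy f + ennreal (1 + 1 / s) * energy g"
    if "0 < s" for s
    unfolding energy_def by (rule nn_integral_scalar_measure_add_le[OF L2 that]) simp
  show dom: "(\<lambda>x. f x + g x) \<in> form_dom_of m L"
    using le[of 1] f g L2 by (auto simp: form_dom_of_iff L2_add ennreal_mult_less_top intro: le_less_trans)
  have "ennreal (form_of m L (\<lambda>x. f x + g x) (\<lambda>x. f x + g x)) \<le>
      ennreal ((1 + t) * form_of m L f f + (1 + 1 / t) * form_of m L g g)"
    using le[OF t] f g dom t form_of_self by (simp add: ennreal_plus ennreal_mult)
  then show "form_of m L (\<lambda>x. f x + g x) (\<lambda>x. f x + g x) \<le> (1 + t) * form_of m L f f + (1 + 1 / t) * form_of m L g g"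
    using f g t form_of_self(2) by (subst (asm) ennreal_le_iff) auto
qed

lemma form_diff_dom:
  assumes "f \<in> form_dom_of m L" "g \<in> form_dom_of m L"
  shows "(\<lambda>x. f x - g x) \<in> form_dom_of m L"
proof -
  have L2: "f \<in> L2 m" "g \<in> L2 m"
    using assms by (auto simp: form_dom_of_iff)
  have "energy (\<lambda>x. f x + g x) + energy (\<lambda>x. f x - g x) \<le> 2 * energy f + 2 * energy g"
    unfolding energy_def by (rule nn_integral_parallelogram[OF L2]) simp
  also have "\<dots> < \<infinity>"
    using assms by (simp add: form_dom_of_iff ennreal_mult_less_top)
  finally show ?thesis
    using L2 by (simp add: form_dom_of_iff L2_diff)
qed

text \<open>Gives meaning to the \<open>lim\<close> in \<open>subcritical\<close>. Each value is at
  most \<open>1 + t\<close> times another plus \<open>1 + 1 / t\<close> times the form of the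
  difference; bounded values permit choosing \<open>t\<close> first and the tolerance for
  differences afterwards.\<close>

lemma form_cauchy_convergent:
  assumes fs: "\<And>n. fs n \<in> form_dom_of m L" and cauchy: "form_cauchy (form_of m L) fs"
  shows "convergent (\<lambda>n. form_of m L (fs n) (fs n))"
proof -
  define c where "c n = form_of m L (fs n) (fs n)" for n
  define e where "e i j = form_of m L (\<lambda>x. fs i x - fs j x) (\<lambda>x. fs i x - fs j x)" for i j
  have c_nonneg: "0 \<le> c n" for n
    unfolding c_def by (rule form_of_self[OF fs])
  have le: "c i \<le> (1 + t) * c j + (1 + 1 / t) * e i j" if "0 < t" for i j t
    using form_add_le(2)[OF fs form_diff_dom[OF fs fs] that, of j i j] by (simp add: c_def e_def)
  have e: "\<exists>N. \<forall>i\<ge>N. \<forall>j\<ge>N. e i j < r" if "0 < r" for r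
    using cauchy that by (simp add: form_cauchy_def e_def)
  obtain N1 where N1: "\<And>i j. N1 \<le> i \<Longrightarrow> N1 \<le> j \<Longrightarrow> e i j < 1"
    using e[of 1] by auto
  \<comment> \<open>The bound for \<open>t = 1\<close> against index \<open>N1\<close>, where
    differences have form below 1; the 2 also makes \<open>K\<close> positive.\<close>
  define K where "K = 2 * c N1 + 2"
  have K: "0 < K"
    using c_nonneg[of N1] by (simp add: K_def)
  have c_le: "c i \<le> K" if "N1 \<le> i" for i
    using le[of 1 i N1] N1[of i N1] that by (simp add: K_def)
  have "Cauchy c"
  proof (rule metric_CauchyI)
    fix r :: real assume r: "0 < r"
    \<comment> \<open>\<open>t\<close> and then \<open>d\<close> are chosen so that each of the two
      error terms is at most \<open>r / 2\<close>.\<close>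
    define t where "t = r / (2 * K)"
    have t: "0 < t" "t * K = r / 2"
      using r K by (auto simp: t_def)
    define d where "d = r / (2 * (1 + 1 / t))"
    have d: "0 < d" "(1 + 1 / t) * d = r / 2"
    proof -
      have "0 < 1 + 1 / t"
        using t by (simp add: add_pos_pos)
      moreover have "s * (r / (2 * s)) = r / 2" if "0 < s" for s
        using that by simp
      ultimately show "0 < d" "(1 + 1 / t) * d = r / 2"
        using r unfolding d_def by (simp, blast)
    qed
    obtain N2 where N2: "\<And>i j. N2 \<le> i \<Longrightarrow> N2 \<le> j \<Longrightarrow> e i j < d"
      using e[OF d(1)] by auto
    have one: "c i - c j < r" if "max N1 N2 \<le> i" "max N1 N2 \<le> j" for i j
    proof -
      have "t * c j \<le> t * K"
        using c_le[of j] that t by simp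
      moreover have "(1 + 1 / t) * e i j < (1 + 1 / t) * d"
        using N2[of i j] that t by (intro mult_strict_left_mono) (auto simp: add_pos_pos)
      ultimately show ?thesis
        using le[OF t(1), of i j] unfolding t(2) d(2) distrib_right[of 1 t] by linarith
    qed
    show "\<exists>N. \<forall>i\<ge>N. \<forall>j\<ge>N. dist (c i) (c j) < r"
    proof (intro exI allI impI)
      fix i j assume "max N1 N2 \<le> i" "max N1 N2 \<le> j"
      then show "dist (c i) (c j) < r"
        using one[of i j] one[of j i] by (simp add: dist_real_def abs_less_iff)
    qed
  qed
  then show ?thesis
    by (simp add: c_def[abs_def] Cauchy_convergent_iff)
qed

end

section \<open>Bernstein functions\<close>

context
  fixes \<nu> :: "real measure"
  assumes levy: "levy_measure \<nu>"
begin

lemma sets_levy [measurable_cong]: "sets \<nu> = sets borel"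
  using levy by (simp add: levy_measure_def)

lemma space_levy: "space \<nu> = UNIV"
  using sets_eq_imp_space_eq[OF sets_levy] by simp

lemma AE_levy_pos: "AE s in \<nu>. 0 < s"
  using levy by (intro AE_I'[of "{..0}"]) (auto simp: levy_measure_def null_sets_def)

lemma integrable_levy_min: "integrable \<nu> (\<lambda>s. min 1 s)"
proof (rule integrableI_nonneg)
  show "AE s in \<nu>. 0 \<le> min 1 s"
    using AE_levy_pos by eventually_elim simp
qed (use levy in \<open>simp_all add: levy_measure_def\<close>)

text \<open>\<open>\<nu>\<close> may have infinite mass near 0. Sigma-finiteness makes the integral
  in \<open>bernstein\<close> measurable in \<open>l\<close>.\<close>

lemma sigma_finite_levy: "sigma_finite_measure \<nu>"
proof
  let ?A = "insert {..0} (range (\<lambda>n::nat. {inverse (real (Suc n))..real n}))"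
  show "\<exists>A. countable A \<and> A \<subseteq> sets \<nu> \<and> \<Union> A = space \<nu> \<and> (\<forall>a\<in>A. emeasure \<nu> a \<noteq> \<infinity>)"
  proof (intro exI conjI ballI)
    show "countable ?A"
      by simp
    show "?A \<subseteq> sets \<nu>"
      by (auto simp: sets_levy)
    have "\<exists>n. inverse (real (Suc n)) \<le> s \<and> s \<le> real n" if "0 < s" for s :: real
    proof -
      obtain k where k: "inverse (real (Suc k)) < s"
        using reals_Archimedean[OF \<open>0 < s\<close>] by blast
      obtain j :: nat where j: "s \<le> j"
        using real_arch_simple by blast
      have "inverse (real (Suc (max k j))) \<le> inverse (real (Suc k))"
        by (intro le_imp_inverse_le) auto
      also note k
      finally have "inverse (real (Suc (max k j))) \<le> s"
        by simp
      moreover have "s \<le> real (max k j)"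
        using j by simp
      ultimately show ?thesis
        by blast
    qed
    then have "s \<in> \<Union> ?A" for s
      by (cases "s \<le> 0") (auto simp: not_le)
    then show "\<Union> ?A = space \<nu>"
      unfolding space_levy by blast
    fix a assume "a \<in> ?A"
    then consider "a = {..0}" | n where "a = {inverse (real (Suc n))..real n}"
      by blast
    then show "emeasure \<nu> a \<noteq> \<infinity>"
    proof cases
      case 1
      then show ?thesis
        using levy by (simp add: levy_measure_def)
    next
      case 2
      have "0 < s" if "inverse (real (Suc n)) \<le> s" for s
        by (rule less_le_trans[OF _ that]) simp
      then have "a \<subseteq> {0<..}"
        unfolding 2 by (meson atLeastAtMost_iff greaterThan_iff subsetI)
      then have "emeasure \<nu> a < \<infinity>"
        using levy 2 unfolding levy_measure_def by (metis compact_Icc)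
      then show ?thesis
        by simp
    qed
  qed
qed

lemma borel_measurable_bernstein: "bernstein b \<nu> \<in> borel_measurable borel"
proof -
  interpret sigma_finite_measure \<nu>
    by (rule sigma_finite_levy)
  show ?thesis
    unfolding bernstein_def[abs_def] by measurable
qed

text \<open>Combines \<open>1 - exp (- x) \<ge> 1 - 1 / (1 + x) \<ge> min 1 x / 2\<close> for
  \<open>x = l * s\<close> with \<open>min 1 (l * s) \<ge> min 1 l * min 1 s\<close>, which
  separates \<open>l\<close> from \<open>s\<close>.\<close>

lemma bernstein_lower_bound:
  assumes b: "0 \<le> b" and nontrivial: "0 < b \<or> levy_support \<nu> \<noteq> {}"
  obtains c where "0 < c" "\<And>l. 0 \<le> l \<Longrightarrow> c * min 1 l \<le> bernstein b \<nu> l"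
proof -
  define I where "I = (LINT s|\<nu>. min 1 s)"
  have I_nonneg: "0 \<le> I"
    unfolding I_def using AE_levy_pos by (intro integral_nonneg_AE) (auto elim: AE_mp)
  \<comment> \<open>If \<open>I\<close> were 0, then \<open>{0<..}\<close> would be a null set,
    although it is an open neighbourhood of every point of the support.\<close>
  have I_pos: "0 < I" if ne: "levy_support \<nu> \<noteq> {}"
  proof (rule ccontr)
    assume "\<not> 0 < I"
    then have "I = 0"
      using I_nonneg by simp
    then have "AE s in \<nu>. min 1 s = 0"
      unfolding I_def using AE_levy_pos
      by (subst (asm) integral_nonneg_eq_0_iff_AE[OF integrable_levy_min]) (auto elim: AE_mp)
    then have "AE s in \<nu>. \<not> 0 < s"
      by eventually_elim (auto simp: min_def split: if_splits)
    then have "emeasure \<nu> {0<..} = 0"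
      by (subst (asm) AE_iff_measurable[of "{0<..}"]) (auto simp: sets_levy space_levy)
    moreover obtain s where "0 < s" "\<And>U. open U \<Longrightarrow> s \<in> U \<Longrightarrow> 0 < emeasure \<nu> U"
      using ne unfolding levy_support_def by blast
    ultimately show False
      by (metis greaterThan_iff less_irrefl open_greaterThan)
  qed
  show thesis
  \<comment> \<open>\<open>b\<close> comes from the drift via \<open>l \<ge> min 1 l\<close>, and
    \<open>I / 2\<close> from integrating the pointwise bound in \<open>s\<close>.\<close>
  proof (rule that[of "b + I / 2"])
    show "0 < b + I / 2"
    proof (cases "0 < b")
      case True
      then show ?thesis
        using I_nonneg by simp
    next
      case False
      then have "0 < I"
        using nontrivial by (intro I_pos) blast
      then show ?thesis
        using b by simp
    qed
    fix l :: real assume l: "0 \<le> l"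
    have exp_le: "exp (- x) \<le> 1 / (1 + x)" if "0 \<le> x" for x :: real
      using exp_ge_add_one_self[of x] that
      by (simp add: exp_minus inverse_eq_divide frac_le add_pos_nonneg)
    have lower: "min 1 l / 2 * min 1 s \<le> 1 - exp (- l * s)" if s: "0 < s" for s
    proof -
      let ?x = "l * s"
      have x: "0 \<le> ?x"
        using l s by simp
      have "min 1 l * min 1 s \<le> min 1 ?x"
      proof (rule min.boundedI)
        show "min 1 l * min 1 s \<le> 1"
          using l s by (intro mult_le_one) auto
        show "min 1 l * min 1 s \<le> ?x"
          using l s by (intro mult_mono) auto
      qed
      also have "\<dots> \<le> 2 * (1 - 1 / (1 + ?x))"
      proof -
        have "min 1 y \<le> 2 * (1 - 1 / (1 + y))" if "0 \<le> y" for y :: real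
        proof (cases "y \<le> 1")
          case True
          have "y * y \<le> 1 * y"
            using True that by (intro mult_right_mono) auto
          then show ?thesis
            using True that by (simp add: field_simps)
        next
          case False
          then show ?thesis
            by (simp add: field_simps)
        qed
        then show ?thesis
          using x by blast
      qed
      also have "\<dots> \<le> 2 * (1 - exp (- ?x))"
        using exp_le[OF x] by simp
      finally show ?thesis
        by simp
    qed
    \<comment> \<open>Ensures integrability of \<open>1 - exp (- l * s)\<close>, without which the
      Bochner integral would default to 0 and the comparison would break down.\<close>
    have upper: "\<bar>1 - exp (- l * s)\<bar> \<le> max 1 l * min 1 s" if s: "0 < s" for s
    proof -
      have x: "0 \<le> l * s"
        using l s by simp
      have "\<bar>1 - exp (- l * s)\<bar> = 1 - exp (- l * s)"
        using x by simp
      also have "\<dots> \<le> min 1 (l * s)"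
        using exp_ge_add_one_self[of "- l * s"] by simp
      also have "\<dots> \<le> max 1 l * min 1 s"
      proof (cases "s \<le> 1")
        case True
        have "l * s \<le> max 1 l * s"
          using s by (intro mult_right_mono) auto
        then show ?thesis
          using True by (simp add: min.coboundedI2)
      next
        case False
        then show ?thesis
          by (simp add: min.coboundedI1)
      qed
      finally show ?thesis .
    qed
    have int: "integrable \<nu> (\<lambda>s. 1 - exp (- l * s))"
    proof (rule Bochner_Integration.integrable_bound)
      show "integrable \<nu> (\<lambda>s. max 1 l * min 1 s)"
        by (intro integrable_mult_right integrable_levy_min)
      show "AE s in \<nu>. norm (1 - exp (- l * s)) \<le> norm (max 1 l * min 1 s)"
        using AE_levy_pos by eventually_elim (use upper in \<open>auto intro: order_trans[OF _ abs_ge_self]\<close>)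
    qed measurable
    have "min 1 l / 2 * I = (LINT s|\<nu>. min 1 l / 2 * min 1 s)"
      by (simp add: I_def)
    also have "\<dots> \<le> (LINT s|\<nu>. 1 - exp (- l * s))"
    proof (rule integral_mono_AE[OF _ int])
      show "integrable \<nu> (\<lambda>s. min 1 l / 2 * min 1 s)"
        by (intro integrable_mult_right integrable_levy_min)
      show "AE s in \<nu>. min 1 l / 2 * min 1 s \<le> 1 - exp (- l * s)"
        using AE_levy_pos by eventually_elim (rule lower)
    qed
    finally have "min 1 l / 2 * I \<le> (LINT s|\<nu>. 1 - exp (- l * s))" .
    moreover have "b * min 1 l \<le> b * l"
      using b by (intro mult_left_mono) auto
    ultimately show "(b + I / 2) * min 1 l \<le> bernstein b \<nu> l"
      by (simp add: bernstein_def algebra_simps)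
  qed
qed

end

section \<open>Subcriticality of the subordinated form\<close>

lemma op_neg_iff: "(f, h) \<in> op_neg A \<longleftrightarrow> (f, \<lambda>x. - h x) \<in> A"
proof
  assume "(f, h) \<in> op_neg A"
  then show "(f, \<lambda>x. - h x) \<in> A"
    by (auto simp: op_neg_def)
next
  assume "(f, \<lambda>x. - h x) \<in> A"
  then have "(f, \<lambda>x. - (- h x)) \<in> op_neg A"
    unfolding op_neg_def by (intro CollectI exI[of _ f] exI[of _ "\<lambda>x. - h x"] conjI refl)
  then show "(f, h) \<in> op_neg A"
    by simp
qed

lemma op_neg_op_neg [simp]: "op_neg (op_neg A) = A"
  by (simp add: set_eq_iff op_neg_iff split_paired_all)

text \<open>The bound \<open>e\<close> stands for the subordinated form of \<open>f\<close>. Leaving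
  it abstract keeps this estimate within the single spectral measure \<open>P\<close>.\<close>

lemma (in nonneg_resolution) weighted_L1_bound:
  assumes "subcritical m (form_dom_of m L) (form_of m L)" and c: "0 < c"
  obtains g K where "\<And>x. 0 < g x" "bounded (range g)" "integrable m g" "0 < K"
    "\<And>f e. f \<in> L2 m \<Longrightarrow> 0 \<le> e \<Longrightarrow> (\<integral>\<^sup>+l. ennreal (c * min 1 l) \<partial>M f) \<le> ennreal e \<Longrightarrow>
      (\<integral>\<^sup>+x. ennreal (\<bar>f x\<bar> * g x) \<partial>m) \<le> ennreal (K * sqrt e)"
proof -
  obtain g where g: "\<And>x. 0 < g x" "bounded (range g)" "integrable m g"
    and sub: "\<And>f fs. f \<in> extended_space m (form_dom_of m L) (form_of m L) \<Longrightarrow>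
      ext_approx m (form_dom_of m L) (form_of m L) f fs \<Longrightarrow>
      (\<integral>\<^sup>+x. ennreal (\<bar>f x\<bar> * g x) \<partial>m) \<le> ennreal (sqrt (lim (\<lambda>n. form_of m L (fs n) (fs n))))"
    using assms unfolding subcritical_def by blast
  note [measurable] = borel_measurable_integrable[OF g(3)]
  have gL2: "g \<in> L2 m"
    by (rule L2_bounded_integrable[OF g(3,2)])
  have sub_dom: "(\<integral>\<^sup>+x. ennreal (\<bar>h x\<bar> * g x) \<partial>m) \<le> ennreal (sqrt (form_of m L h h))"
    if h: "h \<in> form_dom_of m L" for h
  proof -
    \<comment> \<open>Needed for constant sequences to be Cauchy, through which the bound on the
      extended space specializes to the domain.\<close>
    have "form_of m L (\<lambda>x. 0) (\<lambda>x. 0) = 0"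
    proof -
      have dom: "(\<lambda>x. 0) \<in> form_dom_of m L"
        using form_diff_dom[OF h h] by simp
      have "emeasure (M (\<lambda>x. 0)) (space (M (\<lambda>x. 0))) = 0"
        by (simp add: emeasure_scalar_measure L2_zero proj_UNIV l2_inner_zero_left)
      then have "energy (\<lambda>x. 0) = 0"
        unfolding energy_def
        by (subst nn_integral_0_iff_AE)
          (auto intro!: AE_I'[of UNIV] simp: null_sets_def measurable_cong_sets[OF sets_scalar_measure refl])
      then show ?thesis
        using form_of_self[OF dom] by (simp add: ennreal_eq_0_iff)
    qed
    then have approx: "ext_approx m (form_dom_of m L) (form_of m L) h (\<lambda>n. h)"
      using h by (simp add: ext_approx_def form_cauchy_def)
    moreover have "h \<in> extended_space m (form_dom_of m L) (form_of m L)"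
      using approx h L2_measurable unfolding extended_space_def form_dom_of_iff by blast
    ultimately show ?thesis
      using sub[of h "\<lambda>n. h"] by (simp add: lim_const)
  qed
  \<comment> \<open>Both parts are bounded through \<open>sqrt (e / c)\<close>: the summand 1
    belongs to the low part, the norm of \<open>g\<close> to the high part.\<close>
  define K where "K = (1 + sqrt (l2_inner m g g)) / sqrt c"
  have norm_g: "0 \<le> sqrt (l2_inner m g g)"
    by (simp add: l2_inner_nonneg)
  have K: "0 < K"
    using c norm_g by (simp add: K_def add_pos_nonneg)
  have bound: "(\<integral>\<^sup>+x. ennreal (\<bar>f x\<bar> * g x) \<partial>m) \<le> ennreal (K * sqrt e)"
    if f: "f \<in> L2 m" and e: "0 \<le> e" and le: "(\<integral>\<^sup>+l. ennreal (c * min 1 l) \<partial>M f) \<le> ennreal e" for f e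
  proof -
    \<comment> \<open>Up to a null set of \<open>M f\<close> this is the interval from 0 to 1, and
      almost every point of its complement exceeds 1.\<close>
    let ?C = "{-1..1::real}"
    let ?h = "P ?C f"
    let ?r = "\<lambda>x. f x - ?h x"
    have hL2: "?h \<in> L2 m" and rL2: "?r \<in> L2 m"
      using f by (auto intro!: L2_diff proj_L2)
    note [measurable] = f[THEN L2_measurable] hL2[THEN L2_measurable]
    have h_energy: "ennreal c * energy ?h \<le> ennreal e"
    proof -
      have "energy ?h = (\<integral>\<^sup>+l. indicator ?C l * ennreal l \<partial>M f)"
        unfolding energy_def by (rule nn_integral_proj[OF _ _ f]) auto
      moreover have "(\<lambda>l. indicator ?C l * ennreal l) \<in> borel_measurable (M f)"
        unfolding measurable_cong_sets[OF sets_scalar_measure refl] by measurable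
      ultimately have "ennreal c * energy ?h = (\<integral>\<^sup>+l. ennreal c * (indicator ?C l * ennreal l) \<partial>M f)"
        by (simp add: nn_integral_cmult)
      also have "\<dots> \<le> (\<integral>\<^sup>+l. ennreal (c * min 1 l) \<partial>M f)"
      proof (rule nn_integral_mono_AE, use AE_nonneg[OF f] in eventually_elim)
        case (elim l)
        then show ?case
          using c by (auto simp: indicator_def min_def simp flip: ennreal_mult)
      qed
      finally show ?thesis
        using le by (rule order_trans)
    qed
    then have "energy ?h < \<infinity>"
      using c by (cases "energy ?h = \<infinity>") (auto simp: ennreal_mult_top top_unique less_top)
    then have h_dom: "?h \<in> form_dom_of m L"
      using hL2 by (simp add: form_dom_of_iff)
    have "c * form_of m L ?h ?h \<le> e"
      using h_energy c e form_of_self[OF h_dom] by (simp flip: ennreal_mult)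
    then have "form_of m L ?h ?h \<le> e / c"
      using c by (simp add: field_simps)
    then have h_form: "sqrt (form_of m L ?h ?h) \<le> sqrt (e / c)"
      by simp
    have r_eq: "l2_inner m ?r ?r = measure (M f) (- ?C)"
    proof -
      interpret finite_measure "M f"
        by (rule finite_scalar_measure[OF f])
      have "measure (M f) (- ?C) = measure (M f) UNIV - measure (M f) ?C"
        using finite_measure_compl[of ?C] by (simp add: Compl_eq_Diff_UNIV)
      then show ?thesis
        using f by (simp add: inner_compl_proj measure_scalar_measure proj_UNIV)
    qed
    have "ennreal (c * l2_inner m ?r ?r) = (\<integral>\<^sup>+l. ennreal c * indicator (- ?C) l \<partial>M f)"
      using c f by (simp add: r_eq ennreal_mult nn_integral_cmult_indicator emeasure_eq_measure)
    also have "\<dots> \<le> (\<integral>\<^sup>+l. ennreal (c * min 1 l) \<partial>M f)"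
    proof (rule nn_integral_mono_AE, use AE_nonneg[OF f] in eventually_elim)
      case (elim l)
      then show ?case
        using c by (auto simp: indicator_def min_def)
    qed
    also note le
    finally have "l2_inner m ?r ?r \<le> e / c"
      using c e by (simp add: ennreal_le_iff field_simps)
    then have r_norm: "sqrt (l2_inner m ?r ?r) \<le> sqrt (e / c)"
      by simp
    have r_le: "(\<integral>\<^sup>+x. ennreal (\<bar>?r x\<bar> * g x) \<partial>m) \<le> ennreal (sqrt (e / c) * sqrt (l2_inner m g g))"
    proof -
      have abs_L2: "(\<lambda>x. \<bar>?r x\<bar>) \<in> L2 m"
        by (rule L2_abs[OF rL2])
      have "(\<integral>\<^sup>+x. ennreal (\<bar>?r x\<bar> * g x) \<partial>m) = ennreal (l2_inner m (\<lambda>x. \<bar>?r x\<bar>) g)"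
        unfolding l2_inner_def
        by (rule nn_integral_eq_integral[OF L2_integrable_mult[OF abs_L2 gL2]])
          (auto intro!: AE_I2 mult_nonneg_nonneg less_imp_le[OF g(1)])
      also have "\<dots> \<le> ennreal (sqrt (l2_inner m ?r ?r) * sqrt (l2_inner m g g))"
        using l2_Cauchy_Schwarz[OF abs_L2 gL2] by (intro ennreal_leI) (simp add: l2_inner_def)
      also have "\<dots> \<le> ennreal (sqrt (e / c) * sqrt (l2_inner m g g))"
        by (intro ennreal_leI mult_right_mono r_norm norm_g)
      finally show ?thesis .
    qed
    have "(\<integral>\<^sup>+x. ennreal (\<bar>f x\<bar> * g x) \<partial>m) \<le> (\<integral>\<^sup>+x. ennreal (\<bar>?h x\<bar> * g x) + ennreal (\<bar>?r x\<bar> * g x) \<partial>m)"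
    proof (rule nn_integral_mono)
      fix x
      have "\<bar>f x\<bar> * g x \<le> (\<bar>?h x\<bar> + \<bar>?r x\<bar>) * g x"
        using g(1)[of x] by (intro mult_right_mono) auto
      then show "ennreal (\<bar>f x\<bar> * g x) \<le> ennreal (\<bar>?h x\<bar> * g x) + ennreal (\<bar>?r x\<bar> * g x)"
        using g(1)[of x] by (simp add: distrib_right ennreal_leI less_imp_le flip: ennreal_plus)
    qed
    also have "\<dots> = (\<integral>\<^sup>+x. ennreal (\<bar>?h x\<bar> * g x) \<partial>m) + (\<integral>\<^sup>+x. ennreal (\<bar>?r x\<bar> * g x) \<partial>m)"
      by (rule nn_integral_add) measurable
    also have "\<dots> \<le> ennreal (sqrt (e / c)) + ennreal (sqrt (e / c) * sqrt (l2_inner m g g))"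
      by (intro add_mono order_trans[OF sub_dom[OF h_dom]] ennreal_leI h_form r_le)
    also have "\<dots> = ennreal (K * sqrt e)"
      using c e norm_g
      by (simp add: K_def real_sqrt_divide field_simps flip: ennreal_plus)
    finally show ?thesis .
  qed
  show thesis
    by (rule that[OF g K bound])
qed

text \<open>Dividing the weight by \<open>K\<close> normalizes the constant. Fatou's lemma then
  passes to the extended space, where the form values converge along the approximating
  sequence.\<close>

lemma (in nonneg_resolution) subcriticalI:
  assumes g: "\<And>x. 0 < g x" "bounded (range g)" "integrable m g" and K: "0 < K"
    and bound: "\<And>f. f \<in> form_dom_of m L \<Longrightarrow>
      (\<integral>\<^sup>+x. ennreal (\<bar>f x\<bar> * g x) \<partial>m) \<le> ennreal (K * sqrt (form_of m L f f))"
  shows "subcritical m (form_dom_of m L) (form_of m L)"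
  unfolding subcritical_def
proof (intro exI[of _ "\<lambda>x. g x / K"] conjI allI ballI impI)
  note [measurable] = borel_measurable_integrable[OF g(3)]
  show "0 < g x / K" for x
    using g K by simp
  show "bounded (range (\<lambda>x. g x / K))"
    using bounded_scaleR_comp[OF g(2), of "inverse K"] by (simp add: divide_inverse mult.commute)
  show "integrable m (\<lambda>x. g x / K)"
    using g by simp
  fix f fs
  assume "f \<in> extended_space m (form_dom_of m L) (form_of m L)"
    and approx: "ext_approx m (form_dom_of m L) (form_of m L) f fs"
  then have [measurable]: "f \<in> borel_measurable m"
    by (simp add: extended_space_def)
  have fs: "fs n \<in> form_dom_of m L" for n
    using approx by (simp add: ext_approx_def)
  then have [measurable]: "fs n \<in> borel_measurable m" for n
    using form_dom_of_iff L2_measurable by blast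
  let ?c = "\<lambda>n. form_of m L (fs n) (fs n)"
  have "convergent ?c"
    using approx by (intro form_cauchy_convergent) (auto simp: ext_approx_def)
  then have lim: "?c \<longlonglongrightarrow> lim ?c"
    by (simp add: convergent_LIMSEQ_iff)
  have le: "(\<integral>\<^sup>+x. ennreal (\<bar>fs n x\<bar> * (g x / K)) \<partial>m) \<le> ennreal (sqrt (?c n))" for n
  proof -
    have "(\<integral>\<^sup>+x. ennreal (\<bar>fs n x\<bar> * (g x / K)) \<partial>m) = (\<integral>\<^sup>+x. ennreal (1 / K) * ennreal (\<bar>fs n x\<bar> * g x) \<partial>m)"
      using g K by (intro nn_integral_cong) (simp add: less_imp_le flip: ennreal_mult)
    also have "\<dots> = ennreal (1 / K) * (\<integral>\<^sup>+x. ennreal (\<bar>fs n x\<bar> * g x) \<partial>m)"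
      by (rule nn_integral_cmult) measurable
    also have "\<dots> \<le> ennreal (1 / K) * ennreal (K * sqrt (?c n))"
      by (intro mult_left_mono bound fs) simp
    also have "\<dots> = ennreal (sqrt (?c n))"
      using K form_of_self(2)[OF fs] by (simp flip: ennreal_mult)
    finally show ?thesis .
  qed
  have "(\<integral>\<^sup>+x. ennreal (\<bar>f x\<bar> * (g x / K)) \<partial>m) \<le> (\<integral>\<^sup>+x. liminf (\<lambda>n. ennreal (\<bar>fs n x\<bar> * (g x / K))) \<partial>m)"
  proof (rule nn_integral_mono_AE)
    have "AE x in m. (\<lambda>n. fs n x) \<longlonglongrightarrow> f x"
      using approx by (simp add: ext_approx_def)
    then show "AE x in m. ennreal (\<bar>f x\<bar> * (g x / K)) \<le> liminf (\<lambda>n. ennreal (\<bar>fs n x\<bar> * (g x / K)))"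
    proof eventually_elim
      case (elim x)
      have "(\<lambda>n. ennreal (\<bar>fs n x\<bar> * (g x / K))) \<longlonglongrightarrow> ennreal (\<bar>f x\<bar> * (g x / K))"
        by (intro tendsto_ennrealI tendsto_mult tendsto_rabs elim tendsto_const)
      from lim_imp_Liminf[OF sequentially_bot this] show ?case
        by (rule eq_refl[OF sym])
    qed
  qed
  also have "\<dots> \<le> liminf (\<lambda>n. \<integral>\<^sup>+x. ennreal (\<bar>fs n x\<bar> * (g x / K)) \<partial>m)"
    by (rule nn_integral_liminf) measurable
  also have "\<dots> \<le> liminf (\<lambda>n. ennreal (sqrt (?c n)))"
    by (intro Liminf_mono always_eventually allI le)
  also have "\<dots> = ennreal (sqrt (lim ?c))"
    by (intro lim_imp_Liminf sequentially_bot tendsto_ennrealI tendsto_real_sqrt lim)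
  finally show "(\<integral>\<^sup>+x. ennreal (\<bar>f x\<bar> * (g x / K)) \<partial>m) \<le> ennreal (sqrt (lim ?c))" .
qed

lemma nonpositive_op_resolution:
  assumes P: "spectral_resolution m (op_neg L) P" and nonpos: "nonpositive_op m L"
  shows "nonneg_resolution m P L"
proof (rule nonneg_resolutionI[OF P])
  show "0 \<le> l2_inner m k h" if "(h, k) \<in> op_neg L" for h k
    using nonpos that by (force simp: op_neg_iff nonpositive_op_def l2_inner_uminus_left)
qed

text \<open>A member of the form domain already provides a spectral resolution, since
  \<open>fun_calc\<close> collects its pairs from resolutions.\<close>

lemma form_dom_of_diff:
  assumes nonpos: "nonpositive_op m L" and f: "f \<in> form_dom_of m L" and g: "g \<in> form_dom_of m L"
  shows "(\<lambda>x. f x - g x) \<in> form_dom_of m L"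
proof -
  obtain P where "spectral_resolution m (op_neg L) P"
    using f by (auto simp: form_dom_of_def fun_calc_def)
  from nonneg_resolution.form_diff_dom[OF nonpositive_op_resolution[OF this nonpos] f g] show ?thesis .
qed

text \<open>If \<open>\<Phi>(A)\<close> had no spectral resolution, the domain of its form would be empty and subcriticality
  vacuous; so the spectral theorem is not needed.\<close>

lemma subordinate_subcritical:
  assumes nonpos: "nonpositive_op m L"
    and sub: "subcritical m (form_dom_of m L) (form_of m L)"
    and \<Phi> [measurable]: "\<Phi> \<in> borel_measurable borel"
    and c: "0 < c" and \<Phi>_ge: "\<And>l. 0 \<le> l \<Longrightarrow> c * min 1 l \<le> \<Phi> l"
  shows "subcritical m (form_dom_of m (subordinate_op m \<Phi> L)) (form_of m (subordinate_op m \<Phi> L))"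
proof (cases "\<exists>Q. spectral_resolution m (op_neg (subordinate_op m \<Phi> L)) Q")
  case False
  then have "form_dom_of m (subordinate_op m \<Phi> L) = {}"
    by (auto simp: form_dom_of_def fun_calc_def)
  then show ?thesis
    using sub by (auto simp: subcritical_def extended_space_def ext_approx_def)
next
  case True
  let ?B = "subordinate_op m \<Phi> L"
  have B: "op_neg ?B = fun_calc m \<Phi> (op_neg L)"
    by (simp add: subordinate_op_def)
  from True obtain Q where Q: "spectral_resolution m (op_neg ?B) Q"
    by blast
  have \<Phi>_nonneg: "0 \<le> \<Phi> l" if "0 \<le> l" for l
  proof -
    have "0 \<le> c * min 1 l"
      using c that by simp
    also have "\<dots> \<le> \<Phi> l"
      by (rule \<Phi>_ge[OF that])
    finally show ?thesis .
  qed
  have B_nonneg: "0 \<le> l2_inner m k h" if "(h, k) \<in> op_neg ?B" for h k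
  proof -
    obtain P where P: "spectral_resolution m (op_neg L) P" and hk: "(h, k) \<in> spectral_integral m P \<Phi>"
      using \<open>(h, k) \<in> op_neg ?B\<close> by (auto simp: B fun_calc_def)
    interpret P: nonneg_resolution m P L
      by (rule nonpositive_op_resolution[OF P nonpos])
    have "h \<in> L2 m"
      using hk by (auto simp: spectral_integral_def spectral_domain_def)
    then have "AE l in P.M h. 0 \<le> l"
      by (rule P.AE_nonneg)
    then have "AE l in P.M h. 0 \<le> \<Phi> l"
      by eventually_elim (rule \<Phi>_nonneg)
    then show ?thesis
      unfolding P.spectral_integral_inner[OF \<Phi> hk] by (rule integral_nonneg_AE)
  qed
  interpret Q: nonneg_resolution m Q ?B
    by (rule nonneg_resolutionI[OF Q B_nonneg])
  \<comment> \<open>A vector minus itself is literally the zero function. That the graph of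
    \<open>\<Phi>(A)\<close> is thus nonempty produces a resolution \<open>P\<close> of
    \<open>A\<close>.\<close>
  have "(\<lambda>x. 0) \<in> spectral_domain m Q (\<lambda>l. l)"
    using Q.proj_in_spectral_domain[of "{}" "\<lambda>l. l" "\<lambda>x. 0" 0] Q.spectral_domain_add_diff(2)[of "\<lambda>l. l" "Q {} (\<lambda>x. 0)" "Q {} (\<lambda>x. 0)"]
    by (simp add: L2_zero)
  then obtain k where "((\<lambda>x. 0), k) \<in> op_neg ?B"
    using Q.spectral_integral_exists[of "\<lambda>l. l"] by (auto simp: Q.op_eq)
  then obtain P where P: "spectral_resolution m (op_neg L) P"
    by (auto simp: B fun_calc_def)
  interpret P: nonneg_resolution m P L
    by (rule nonpositive_op_resolution[OF P nonpos])
  \<comment> \<open>The left side is one member of the union defining \<open>\<Phi>(A)\<close>, and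
    \<open>Q\<close> resolves the whole union.\<close>
  have P_sub: "spectral_integral m P \<Phi> \<subseteq> spectral_integral m Q (\<lambda>l. l)"
    unfolding Q.op_eq[symmetric] B fun_calc_def using P by blast
  obtain g K where g: "\<And>x. 0 < g x" "bounded (range g)" "integrable m g" and K: "0 < K"
    and bound: "\<And>f e. f \<in> L2 m \<Longrightarrow> 0 \<le> e \<Longrightarrow> (\<integral>\<^sup>+l. ennreal (c * min 1 l) \<partial>P.M f) \<le> ennreal e \<Longrightarrow>
      (\<integral>\<^sup>+x. ennreal (\<bar>f x\<bar> * g x) \<partial>m) \<le> ennreal (K * sqrt e)"
    using P.weighted_L1_bound[OF sub c] by blast
  show ?thesis
  proof (rule Q.subcriticalI[OF g K])
    fix f assume f: "f \<in> form_dom_of m ?B"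
    then have fL2: "f \<in> L2 m"
      by (simp add: Q.form_dom_of_iff)
    have "(\<integral>\<^sup>+l. ennreal (c * min 1 l) \<partial>P.M f) \<le> (\<integral>\<^sup>+l. ennreal (\<Phi> l) \<partial>P.M f)"
      by (rule nn_integral_mono_AE, use P.AE_nonneg[OF fL2] in eventually_elim)
        (intro ennreal_leI \<Phi>_ge)
    also have "\<dots> \<le> Q.energy f"
      unfolding Q.energy_def
    proof (rule nn_integral_spectral_le[OF P.projection_measure_axioms Q.projection_measure_axioms \<Phi> P_sub _ Q.AE_nonneg fL2])
      show "AE l in P.M f. 0 \<le> \<Phi> l" if "f \<in> L2 m" for f
        using P.AE_nonneg[OF that] by eventually_elim (rule \<Phi>_nonneg)
    qed
    also have "\<dots> = ennreal (form_of m ?B f f)"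
      by (rule Q.form_of_self[OF f])
    finally show "(\<integral>\<^sup>+x. ennreal (\<bar>f x\<bar> * g x) \<partial>m) \<le> ennreal (K * sqrt (form_of m ?B f f))"
      by (rule bound[OF fL2 Q.form_of_self(2)[OF f]])
  qed
qed

text \<open>The Cauchy condition evaluates the forms at differences, so agreement on
  \<open>D\<close> must be paired with closure of \<open>D\<close> under differences.\<close>

lemma subcritical_cong:
  assumes "\<And>f g. f \<in> D \<Longrightarrow> g \<in> D \<Longrightarrow> a f g = a' f g" and diff: "\<And>f g. f \<in> D \<Longrightarrow> g \<in> D \<Longrightarrow> (\<lambda>x. f x - g x) \<in> D"
  shows "subcritical m D a \<longleftrightarrow> subcritical m D a'"
proof -
  have "ext_approx m D a f fs \<longleftrightarrow> ext_approx m D a' f fs" for f fs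
    using assms by (auto simp: ext_approx_def form_cauchy_def)
  moreover have "lim (\<lambda>n. a (fs n) (fs n)) = lim (\<lambda>n. a' (fs n) (fs n))" if "ext_approx m D a' f fs" for f fs
    using that assms by (simp add: ext_approx_def)
  ultimately show ?thesis
    by (simp add: subcritical_def extended_space_def cong: imp_cong)
qed

theorem corollary3p12:
  fixes m \<mu>p \<mu>n :: "'a::{metric_space, second_countable_topology} measure"
    and D :: "('a \<Rightarrow> real) set"
    and a :: "'a l2_form"
    and L\<mu> :: "'a l2_op"
    and b :: real
    and \<nu> :: "real measure"
  defines "C \<equiv> D \<inter> Cc"
  defines "a\<mu> \<equiv> schroedinger_form a \<mu>p \<mu>n"
  defines "\<Phi> \<equiv> bernstein b \<nu>"
  assumes "locally compact (UNIV :: 'a set)"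
    and "radon_measure m" and "full_support m"
    and "dirichlet_form m D a" and "regular_form m D a" and "irreducible_form m D a"
    and "radon_measure \<mu>p" and "smooth_measure m D a \<mu>p"
    and "radon_measure \<mu>n" and "smooth_measure m D a \<mu>n"
    and "form_nonneg C a\<mu>" and "form_closable m C a\<mu>"
    and "form_generator m (closure_dom m C a\<mu>) (closure_form m C a\<mu>) L\<mu>"
    and "0 \<le> b" and "levy_measure \<nu>"
    and "0 < b \<or> Inf (ereal ` levy_support \<nu>) = 0"
    and "subcritical m (closure_dom m C a\<mu>) (closure_form m C a\<mu>)"
  shows "subcritical m (form_dom_of m (subordinate_op m \<Phi> L\<mu>)) (form_of m (subordinate_op m \<Phi> L\<mu>))"
proof -
  let ?D = "closure_dom m C a\<mu>" and ?a = "closure_form m C a\<mu>"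
  have nonpos: "nonpositive_op m L\<mu>" and dom: "?D = form_dom_of m L\<mu>"
    and form: "\<And>f g. f \<in> ?D \<Longrightarrow> g \<in> ?D \<Longrightarrow> ?a f g = form_of m L\<mu> f g"
    using \<open>form_generator m ?D ?a L\<mu>\<close> by (auto simp: form_generator_def)
  have "subcritical m ?D ?a \<longleftrightarrow> subcritical m ?D (form_of m L\<mu>)"
    by (rule subcritical_cong[OF form]) (simp_all add: dom form_dom_of_diff[OF nonpos])
  then have sub: "subcritical m (form_dom_of m L\<mu>) (form_of m L\<mu>)"
    using \<open>subcritical m ?D ?a\<close> by (simp add: dom)
  \<comment> \<open>The infimum of the empty set in \<open>ereal\<close> is
    \<open>\<infinity>\<close>, so an infimum equal to 0 forces a nonempty support.\<close>
  have "0 < b \<or> levy_support \<nu> \<noteq> {}"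
    using \<open>0 < b \<or> Inf (ereal ` levy_support \<nu>) = 0\<close> by (auto simp: top_ereal_def)
  then obtain c where c: "0 < c" "\<And>l. 0 \<le> l \<Longrightarrow> c * min 1 l \<le> bernstein b \<nu> l"
    using bernstein_lower_bound[OF \<open>levy_measure \<nu>\<close> \<open>0 \<le> b\<close>] by blast
  show ?thesis
    unfolding \<Phi>_def
    by (rule subordinate_subcritical[OF nonpos sub borel_measurable_bernstein[OF \<open>levy_measure \<nu>\<close>] c])
qed

end
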